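(* Let $3\le m\le n$, $k\ge2$, and $L=\lfloor k/2\rfloor$. For $0\le s\le L$ let $Y_s$ be the set of points of $\mathcal Z^{m,n}_{2,k}$ at which $x^{(l)}_{i,j}=0$ for all $i,j$ and all $l<s$, and for $0\le s\le L-1$ let $X_s$ be the Zariski closure of the set of points of $Y_s$ at which some $x^{(s)}_{i,j}\neq0$. Then $\mathcal Z^{m,n}_{2,k}$ is reducible, and its irreducible components are exactly $X_0,X_1,\dots,X_{L-1}$ and $Y_L$ (all distinct). The component $X_s$ ($0\le s\le L-1$) has codimension $(m-1)(n-1)(k-2s)+mns$ in $\mathbf A^{mnk}$; $Y_L$ has codimension $mnL$ if $k=2L$, and $(m-1)(n-1)+mnL$ if $k=2L+1$.
   Context: Let $F$ be an algebraically closed field. For integers $1\le r\le m\le n$ and $k\ge 1$, let $S=F[x^{(l)}_{i,j}:1\le i\le m,\ 1\le j\le n,\ 0\le l\le k-1]$, the coordinate ring of $\mathbf A^{mnk}_F$, and let $X(t)$ be the $m\times n$ matrix over $S[t]/(t^k)$ with $(i,j)$ entry $x_{i,j}(t)=\sum_{l=0}^{k-1}x^{(l)}_{i,j}t^l$. Every element of $S[t]/(t^k)$ is uniquely $\sum_{l=0}^{k-1}c_lt^l$ with $c_l\in S$. $\mathcal I^{m,n}_{r,k}\subseteq S$ is the ideal generated by the coefficients of $t^l$, $0\le l\le k-1$, of all $r\times r$ minors of $X(t)$, and $\mathcal Z^{m,n}_{r,k}\subseteq\mathbf A^{mnk}_F$ is its zero set. The variable $x^{(l)}_{i,j}$ has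 degree $l$. *)

theory Defs
  imports "HOL-Computational_Algebra.Polynomial" "HOL-Combinatorics.Permutations"
begin

text \<open>A point of affine space A^{mnk} is encoded as a function p with p i j l = x^{(l)}_{i,j}
  (0-based indices i < m, j < n, l < k), vanishing outside this index range.\<close>

type_synonym 'a pt = "nat \<Rightarrow> nat \<Rightarrow> nat \<Rightarrow> 'a"

definition aff :: "nat \<Rightarrow> nat \<Rightarrow> nat \<Rightarrow> 'a::zero pt set" where
  "aff m n k = {p. \<forall>i j l. (m \<le> i \<or> n \<le> j \<or> k \<le> l) \<longrightarrow> p i j l = 0}"

inductive_set polyfun :: "('a::comm_ring_1 pt \<Rightarrow> 'a) set" where
  pf_const: "(\<lambda>p. c) \<in> polyfun"
| pf_var: "(\<lambda>p. p i j l) \<in> polyfun"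
| pf_add: "f \<in> polyfun \<Longrightarrow> g \<in> polyfun \<Longrightarrow> (\<lambda>p. f p + g p) \<in> polyfun"
| pf_mult: "f \<in> polyfun \<Longrightarrow> g \<in> polyfun \<Longrightarrow> (\<lambda>p. f p * g p) \<in> polyfun"

definition zclosed :: "nat \<Rightarrow> nat \<Rightarrow> nat \<Rightarrow> 'a::comm_ring_1 pt set \<Rightarrow> bool" where
  "zclosed m n k S \<longleftrightarrow> (\<exists>P \<subseteq> polyfun. S = {p \<in> aff m n k. \<forall>f\<in>P. f p = 0})"

definition zclosure :: "nat \<Rightarrow> nat \<Rightarrow> nat \<Rightarrow> 'a::comm_ring_1 pt set \<Rightarrow> 'a pt set" where
  "zclosure m n k T = \<Inter>{S. zclosed m n k S \<and> T \<subseteq> S}"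

definition zirreducible :: "nat \<Rightarrow> nat \<Rightarrow> nat \<Rightarrow> 'a::comm_ring_1 pt set \<Rightarrow> bool" where
  "zirreducible m n k X \<longleftrightarrow> zclosed m n k X \<and> X \<noteq> {} \<and>
     (\<forall>Y1 Y2. zclosed m n k Y1 \<and> zclosed m n k Y2 \<and> X \<subseteq> Y1 \<union> Y2 \<longrightarrow> X \<subseteq> Y1 \<or> X \<subseteq> Y2)"

definition zcomponent :: "nat \<Rightarrow> nat \<Rightarrow> nat \<Rightarrow> 'a::comm_ring_1 pt set \<Rightarrow> 'a pt set \<Rightarrow> bool" where
  "zcomponent m n k Z X \<longleftrightarrow> zirreducible m n k X \<and> X \<subseteq> Z \<and>
     (\<forall>Y. zirreducible m n k Y \<and> X \<subseteq> Y \<and> Y \<subseteq> Z \<longrightarrow> Y = X)"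

definition zcodim :: "nat \<Rightarrow> nat \<Rightarrow> nat \<Rightarrow> 'a::comm_ring_1 pt set \<Rightarrow> nat" where
  "zcodim m n k X = Sup {d. \<exists>C :: nat \<Rightarrow> 'a pt set. C 0 = X \<and>
       (\<forall>i\<le>d. zirreducible m n k (C i)) \<and> (\<forall>i<d. C i \<subset> C (Suc i))}"

definition xpoly :: "nat \<Rightarrow> 'a::comm_ring_1 pt \<Rightarrow> nat \<Rightarrow> nat \<Rightarrow> 'a poly" where
  "xpoly k p i j = (\<Sum>l<k. monom (p i j l) l)"

text \<open>Zero set Z^{m,n}_{r,k}: all coefficients of t^l, l < k, of all r x r minors of X(t) vanish.
  A minor is given by injective row / column selections rho, gamma on {..<r}; its
  determinant (Leibniz formula) is computed in F[t], whose coefficients below t^k agree with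
  those of the minor computed in F[t]/(t^k).\<close>
definition Zlocus :: "nat \<Rightarrow> nat \<Rightarrow> nat \<Rightarrow> nat \<Rightarrow> 'a::comm_ring_1 pt set" where
  "Zlocus m n r k = {p \<in> aff m n k. \<forall>\<rho> \<gamma>.
      inj_on \<rho> {..<r} \<and> \<rho> ` {..<r} \<subseteq> {..<m} \<and> inj_on \<gamma> {..<r} \<and> \<gamma> ` {..<r} \<subseteq> {..<n} \<longrightarrow>
      (\<forall>l<k. coeff (\<Sum>\<sigma> | \<sigma> permutes {..<r}.
                 of_int (sign \<sigma>) * (\<Prod>i<r. xpoly k p (\<rho> i) (\<gamma> (\<sigma> i)))) l = 0)}"

end

theory Submission
  imports Defs "HOL-Library.FuncSet"
begin

text \<open>A point of the locus whose jet has order exactly $s \le k/2$ is $t^s X'$, where $X'$ has a unit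
  entry and vanishing $2 \times 2$ minors modulo $t^{k-2s}$. Hence $X' \equiv u v^T$ modulo $t^{k-2s}$, and
  these points are dense in the image of an affine space under the polynomial map
  $(u, v, W) \mapsto t^s (u v^T + t^{k-2s} W)$. The closure of such an image is irreducible, because any two
  of its points lie on a polynomial curve in the image. The closures are incomparable: the $3 \times 3$
  minors of the $s$-th one have order at least $3s + 2(k-2s) = 2k-s$, which fails for $s' > s$.

  For the codimension, switch on the parameters of an extension of this map to all of affine space
  one by one. This gives a flag of $mnk + 1$ irreducible closed sets in which the closure is a member.
  No chain is longer, because $mnk + 1$ polynomial functions are algebraically dependent, so the
  codimension of each member can be read off from its position.\<close>

section \<open>Polynomial functions and the Zariski topology\<close>

text \<open>Counting all \<open>u\<close>, \<open>v\<close> would overestimate the dimension: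
  \<open>(c u, c^-1 v)\<close> gives the same product for every unit series \<open>c\<close>.
  Setting \<open>u 0 = 1\<close> removes this freedom and leaves
  \<open>(m + n - 1) * (k - 2 * s)\<close> parameters for \<open>u\<close> and \<open>v\<close>,
  besides \<open>m * n * s\<close> free coefficients from \<open>t^(k - s)\<close> on. The price is
  that jets whose \<open>u 0\<close> is not a unit are only limits of parametrized ones; they are
  reached because a polynomial function that vanishes at all but finitely many points of a curve
  vanishes on the whole curve.

  \<open>zcodim\<close> is a supremum of lengths of chains above a set, so an explicit chain above
  bounds it from below only. The upper bound needs an explicit chain below the set as well, and the
  two lengths must add up to exactly \<open>m * n * k\<close>. This is why the parametrization is
  extended to all \<open>m * n * k\<close> coordinates, with one strict inclusion per coordinate.

  The \<open>3 \<times> 3\<close> minors exclude only one direction of containment. In the other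
  direction the order decides: for \<open>s < s'\<close> the coefficients of \<open>t^s\<close>
  vanish on the \<open>s'\<close>-th closure, but not on the \<open>s\<close>-th.\<close>

lemma infinite_UNIV_alg_closed: "infinite (UNIV :: 'a::alg_closed_field set)"
proof
  assume fin: "finite (UNIV :: 'a set)"
  \<comment> \<open>Over a finite field this \<open>Q\<close> would vanish everywhere, and the
    nonconstant \<open>Q + 1\<close> would have no root.\<close>
  define Q where "Q = (\<Prod>a\<in>(UNIV :: 'a set). [:- a, 1:])"
  have "degree Q = card (UNIV :: 'a set)"
    unfolding Q_def by (subst degree_prod_sum_eq) auto
  moreover have "card (UNIV :: 'a set) > 0"
    using fin by (simp add: finite_UNIV_card_ge_0)
  ultimately have "degree (Q + 1) > 0"
    by (subst degree_add_eq_left) auto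
  then obtain x where "poly (Q + 1) x = 0"
    using alg_closed_imp_poly_has_root by blast
  moreover have "poly Q x = 0"
    unfolding Q_def poly_prod using fin by (intro prod_zero) auto
  ultimately show False by simp
qed

lemma poly_zero_cofinite:
  fixes P :: "'a::alg_closed_field poly"
  assumes "finite B" "\<And>x. x \<notin> B \<Longrightarrow> poly P x = 0"
  shows "P = 0"
proof (rule ccontr)
  assume "P \<noteq> 0"
  then have "finite ({x. poly P x = 0} \<union> B)"
    using poly_roots_finite assms(1) by auto
  moreover have "{x. poly P x = 0} \<union> B = UNIV" using assms(2) by blast
  ultimately show False using infinite_UNIV_alg_closed[where 'a = 'a] by metis
qed

lemma pf_uminus: "f \<in> polyfun \<Longrightarrow> (\<lambda>p. - f p) \<in> polyfun"
  using pf_mult[OF pf_const[of "-1"], of f] by simp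

lemma pf_diff: "f \<in> polyfun \<Longrightarrow> g \<in> polyfun \<Longrightarrow> (\<lambda>p. f p - g p) \<in> polyfun"
  using pf_add[OF _ pf_uminus, of f g] by simp

lemma pf_sum: "(\<And>x. x \<in> A \<Longrightarrow> f x \<in> polyfun) \<Longrightarrow> (\<lambda>p. \<Sum>x\<in>A. f x p) \<in> polyfun"
  by (induction A rule: infinite_finite_induct) (simp_all add: pf_const pf_add)

lemma pf_comp:
  assumes "f \<in> polyfun" "\<And>i j l. (\<lambda>q. \<Phi> q i j l) \<in> polyfun"
  shows "(\<lambda>q. f (\<Phi> q)) \<in> polyfun"
  using assms(1) by (induction f rule: polyfun.induct) (simp_all add: polyfun.intros assms(2))

section \<open>Polynomial functions restricted to curves\<close>

definition is_poly :: "('a::comm_ring_1 \<Rightarrow> 'a) \<Rightarrow> bool" where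
  "is_poly F \<longleftrightarrow> (\<exists>P. \<forall>t. F t = poly P t)"

lemma is_poly_const: "is_poly (\<lambda>t. c)"
  unfolding is_poly_def by (rule exI[of _ "[:c:]"]) simp

lemma is_poly_id: "is_poly (\<lambda>t. t)"
  unfolding is_poly_def by (rule exI[of _ "[:0, 1:]"]) simp

lemma is_poly_add: "is_poly F \<Longrightarrow> is_poly G \<Longrightarrow> is_poly (\<lambda>t. F t + G t)"
  unfolding is_poly_def by (metis poly_add)

lemma is_poly_mult: "is_poly F \<Longrightarrow> is_poly G \<Longrightarrow> is_poly (\<lambda>t. F t * G t)"
  unfolding is_poly_def by (metis poly_mult)

lemma is_poly_polyfun:
  assumes "f \<in> polyfun" "\<And>i j l. is_poly (\<lambda>t. c t i j l)"
  shows "is_poly (\<lambda>t. f (c t))"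
  using assms(1)
  by (induction f rule: polyfun.induct)
     (simp_all add: is_poly_const is_poly_add is_poly_mult assms(2))

lemma is_poly_cofinite:
  fixes F :: "'a::alg_closed_field \<Rightarrow> 'a"
  assumes "is_poly F" "finite B" "\<And>t. t \<notin> B \<Longrightarrow> F t = 0"
  shows "F t = 0"
  using assms poly_zero_cofinite[of B] unfolding is_poly_def by (metis poly_0)

text \<open>\<open>F[t]\<close> is a domain and the field is infinite, so the product of the two
  polynomials has a nonroot. All irreducibility below comes from this one-variable fact, applied
  along a curve joining two points.\<close>

lemma is_poly_common_nonzero:
  fixes F G :: "'a::alg_closed_field \<Rightarrow> 'a"
  assumes "is_poly F" "is_poly G" "F a \<noteq> 0" "G b \<noteq> 0"
  shows "\<exists>t. F t \<noteq> 0 \<and> G t \<noteq> 0"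
proof -
  obtain P Q where PQ: "\<And>t. F t = poly P t" "\<And>t. G t = poly Q t"
    using assms(1,2) unfolding is_poly_def by auto
  then have "P * Q \<noteq> 0" using assms(3,4) by auto
  then have "\<exists>t. poly (P * Q) t \<noteq> 0" using poly_zero_cofinite[of "{}" "P * Q"] by auto
  then show ?thesis using PQ by auto
qed

lemma zclosedI_polyfun: "f \<in> polyfun \<Longrightarrow> zclosed m n k {p \<in> aff m n k. f p = 0}"
  unfolding zclosed_def by (rule exI[of _ "{f}"]) auto

lemma zclosed_subset_aff: "zclosed m n k S \<Longrightarrow> S \<subseteq> aff m n k"
  unfolding zclosed_def by auto

lemma zclosed_Un:
  fixes S T :: "'a::idom pt set"
  assumes "zclosed m n k S" "zclosed m n k T"
  shows "zclosed m n k (S \<union> T)"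
proof -
  obtain P Q where PQ: "P \<subseteq> polyfun" "S = {p \<in> aff m n k. \<forall>f\<in>P. f p = 0}"
    "Q \<subseteq> polyfun" "T = {p \<in> aff m n k. \<forall>f\<in>Q. f p = 0}"
    using assms unfolding zclosed_def by auto
  define R where "R = (\<lambda>(f, g) p. f p * g p) ` (P \<times> Q)"
  have "R \<subseteq> polyfun" using PQ unfolding R_def by (auto intro: pf_mult)
  moreover have "S \<union> T = {p \<in> aff m n k. \<forall>f\<in>R. f p = 0}"
    using PQ unfolding R_def by fastforce
  ultimately show ?thesis unfolding zclosed_def by blast
qed

lemma zclosed_empty: "zclosed m n k ({} :: 'a::comm_ring_1 pt set)"
  using zclosedI_polyfun[OF pf_const[of "1 :: 'a"], of m n k] by simp

lemma zclosed_UN: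
  fixes V :: "'b \<Rightarrow> 'a::idom pt set"
  assumes "finite I" "\<And>i. i \<in> I \<Longrightarrow> zclosed m n k (V i)"
  shows "zclosed m n k (\<Union>i\<in>I. V i)"
  using assms by (induction I rule: finite_induct) (auto simp: zclosed_empty zclosed_Un)

lemma zclosure_eq:
  assumes "T \<subseteq> aff m n k"
  shows "zclosure m n k T = {p \<in> aff m n k. \<forall>f\<in>polyfun. (\<forall>q\<in>T. f q = 0) \<longrightarrow> f p = 0}"
    (is "_ = ?R")
proof (rule antisym)
  have "zclosed m n k ?R" unfolding zclosed_def
    by (rule exI[of _ "{f \<in> polyfun. \<forall>q\<in>T. f q = 0}"]) auto
  moreover have "T \<subseteq> ?R" using assms by auto
  ultimately show "zclosure m n k T \<subseteq> ?R" unfolding zclosure_def by blast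
  show "?R \<subseteq> zclosure m n k T"
    unfolding zclosure_def zclosed_def by blast
qed

lemma zclosed_zclosure: "T \<subseteq> aff m n k \<Longrightarrow> zclosed m n k (zclosure m n k T)"
  unfolding zclosed_def
  by (rule exI[of _ "{f \<in> polyfun. \<forall>q\<in>T. f q = 0}"]) (auto simp: zclosure_eq)

lemma zclosure_minimal: "zclosed m n k S \<Longrightarrow> T \<subseteq> S \<Longrightarrow> zclosure m n k T \<subseteq> S"
  unfolding zclosure_def by blast

lemma subset_zclosure: "T \<subseteq> zclosure m n k T"
  unfolding zclosure_def by blast

lemma polyfun_zero_zclosure:
  assumes "T \<subseteq> aff m n k" "f \<in> polyfun" "\<And>q. q \<in> T \<Longrightarrow> f q = 0" "p \<in> zclosure m n k T"
  shows "f p = 0"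
  using assms by (auto simp: zclosure_eq)

text \<open>Along the curve, a polynomial function vanishing on \<open>T\<close> is a polynomial in
  \<open>t\<close> with cofinitely many zeros, hence zero. This is how degenerate jets are
  recognized as limits of generic ones.\<close>

lemma zclosure_curve:
  fixes T :: "'a::alg_closed_field pt set"
  assumes "T \<subseteq> aff m n k" "\<And>i j l. is_poly (\<lambda>t. c t i j l)" "finite B"
    and "\<And>t. t \<notin> B \<Longrightarrow> c t \<in> T" "c t0 \<in> aff m n k"
  shows "c t0 \<in> zclosure m n k T"
proof -
  have "f (c t0) = 0" if "f \<in> polyfun" "\<forall>q\<in>T. f q = 0" for f
    using is_poly_cofinite[OF is_poly_polyfun[where c = c, OF that(1) assms(2)] assms(3)] that(2) assms(4) by blast
  then show ?thesis using assms(1,5) by (auto simp: zclosure_eq)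
qed

lemma zclosed_strict_separation:
  assumes "zclosed m n k S" "S \<subset> S'" "S' \<subseteq> aff m n k"
  shows "\<exists>f\<in>polyfun. (\<forall>p\<in>S. f p = 0) \<and> (\<exists>p\<in>S'. f p \<noteq> 0)"
  using assms unfolding zclosed_def by blast

lemma zirreducible_mult:
  assumes "zirreducible m n k X" "f \<in> polyfun" "g \<in> polyfun"
    and "\<And>p. p \<in> X \<Longrightarrow> f p * g p = (0 :: 'a::idom)"
  shows "(\<forall>p\<in>X. f p = 0) \<or> (\<forall>p\<in>X. g p = 0)"
proof -
  have "X \<subseteq> aff m n k"
    by (rule zclosed_subset_aff) (use assms(1) in \<open>simp add: zirreducible_def\<close>)
  then have "X \<subseteq> {p \<in> aff m n k. f p = 0} \<union> {p \<in> aff m n k. g p = 0}"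
    using assms(4) by fastforce
  then have "X \<subseteq> {p \<in> aff m n k. f p = 0} \<or> X \<subseteq> {p \<in> aff m n k. g p = 0}"
    using assms(1) zclosedI_polyfun[OF assms(2)] zclosedI_polyfun[OF assms(3)]
    unfolding zirreducible_def by blast
  then show ?thesis by blast
qed

text \<open>If \<open>T\<close> lay in neither closed set, each would be avoided by a point of
  \<open>T\<close>, witnessed by one of its equations. The third hypothesis then yields a point of
  \<open>T\<close> violating an equation of both sets at once.\<close>

lemma zirreducible_zclosureI:
  assumes "T \<subseteq> aff m n k" "T \<noteq> {}"
    and "\<And>f g p q. f \<in> polyfun \<Longrightarrow> g \<in> polyfun \<Longrightarrow> p \<in> T \<Longrightarrow> q \<in> T \<Longrightarrow> f p \<noteq> 0 \<Longrightarrow> g q \<noteq> 0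
      \<Longrightarrow> \<exists>r\<in>T. f r \<noteq> 0 \<and> g r \<noteq> 0"
  shows "zirreducible m n k (zclosure m n k T)"
  unfolding zirreducible_def
proof (intro conjI allI impI)
  show "zclosed m n k (zclosure m n k T)" using assms(1) by (rule zclosed_zclosure)
  show "zclosure m n k T \<noteq> {}" using assms(2) subset_zclosure by blast
  fix Y1 Y2
  assume Y: "zclosed m n k Y1 \<and> zclosed m n k Y2 \<and> zclosure m n k T \<subseteq> Y1 \<union> Y2"
  have "T \<subseteq> Y1 \<or> T \<subseteq> Y2"
  proof (rule ccontr)
    assume "\<not> (T \<subseteq> Y1 \<or> T \<subseteq> Y2)"
    then obtain p q where pq: "p \<in> T" "p \<notin> Y1" "q \<in> T" "q \<notin> Y2" by blast
    obtain P1 P2 where P: "P1 \<subseteq> polyfun" "Y1 = {p \<in> aff m n k. \<forall>f\<in>P1. f p = 0}"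
      "P2 \<subseteq> polyfun" "Y2 = {p \<in> aff m n k. \<forall>f\<in>P2. f p = 0}"
      using Y unfolding zclosed_def by auto
    obtain f g where fg: "f \<in> P1" "f p \<noteq> 0" "g \<in> P2" "g q \<noteq> 0"
      using pq P assms(1) by blast
    obtain r where "r \<in> T" "f r \<noteq> 0" "g r \<noteq> 0"
      using assms(3)[of f g p q] fg P pq by blast
    moreover have "r \<in> Y1 \<union> Y2" using \<open>r \<in> T\<close> Y subset_zclosure by blast
    ultimately show False using P fg by blast
  qed
  then show "zclosure m n k T \<subseteq> Y1 \<or> zclosure m n k T \<subseteq> Y2"
    using Y zclosure_minimal by blast
qed

lemma zirreducible_finite_cover:
  fixes V :: "'b \<Rightarrow> 'a::idom pt set"
  assumes "zirreducible m n k C" "finite I" "\<And>i. i \<in> I \<Longrightarrow> zclosed m n k (V i)" "C \<subseteq> (\<Union>i\<in>I. V i)"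
  shows "\<exists>i\<in>I. C \<subseteq> V i"
  using assms(2-4)
proof (induction I rule: finite_induct)
  case empty
  then show ?case using assms(1) unfolding zirreducible_def by auto
next
  case (insert i I)
  have "zclosed m n k (V i)" "zclosed m n k (\<Union>i\<in>I. V i)"
    using insert by (auto intro: zclosed_UN)
  moreover have "C \<subseteq> V i \<union> (\<Union>i\<in>I. V i)" using insert.prems by auto
  ultimately have "C \<subseteq> V i \<or> C \<subseteq> (\<Union>i\<in>I. V i)"
    using assms(1) unfolding zirreducible_def by blast
  then show ?case using insert by blast
qed

text \<open>Every irreducible closed subset of \<open>Z\<close> lies in a single \<open>V i\<close>.
  So a maximal one equals some \<open>V i\<close>, and since no \<open>V i\<close> lies in another,
  each of them is maximal.\<close>

lemma zcomponents_irredundant_cover: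
  fixes V :: "'b \<Rightarrow> 'a::idom pt set"
  assumes "finite I" "\<And>i. i \<in> I \<Longrightarrow> zirreducible m n k (V i)" "Z = (\<Union>i\<in>I. V i)"
    and irr: "\<And>i j. i \<in> I \<Longrightarrow> j \<in> I \<Longrightarrow> V i \<subseteq> V j \<Longrightarrow> i = j"
  shows "{C. zcomponent m n k Z C} = V ` I"
proof (intro set_eqI iffI)
  have cover: "\<exists>i\<in>I. C \<subseteq> V i" if "zirreducible m n k C" "C \<subseteq> Z" for C
    using zirreducible_finite_cover[OF that(1) assms(1), of V] that(2) assms(2,3)
    unfolding zirreducible_def by blast
  fix C
  {
    assume "C \<in> {C. zcomponent m n k Z C}"
    then have C: "zirreducible m n k C" "C \<subseteq> Z"
      "\<And>Y. zirreducible m n k Y \<Longrightarrow> C \<subseteq> Y \<Longrightarrow> Y \<subseteq> Z \<Longrightarrow> Y = C"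
      unfolding zcomponent_def by auto
    then obtain i where "i \<in> I" "C \<subseteq> V i" using cover by blast
    then show "C \<in> V ` I" using C(3)[of "V i"] assms(2,3) by blast
  }
  {
    assume "C \<in> V ` I"
    then obtain i where i: "i \<in> I" "C = V i" by auto
    have "Y = C" if Y: "zirreducible m n k Y" "C \<subseteq> Y" "Y \<subseteq> Z" for Y
    proof -
      obtain j where "j \<in> I" "Y \<subseteq> V j" using cover Y by blast
      then show ?thesis using irr[of i j] i Y by blast
    qed
    then show "C \<in> {C. zcomponent m n k Z C}"
      using i assms(2,3) unfolding zcomponent_def by blast
  }
qed

section \<open>Chains of irreducible closed sets\<close>

lemma homogeneous_system_nontrivial:
  fixes a :: "'b \<Rightarrow> 'c \<Rightarrow> 'a::field"
  assumes "finite J" "finite M" "card J < card M"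
  shows "\<exists>c. (\<exists>x\<in>M. c x \<noteq> 0) \<and> (\<forall>j\<in>J. (\<Sum>x\<in>M. c x * a x j) = 0)"
  using assms
proof (induction J arbitrary: M a rule: finite_induct)
  case empty
  then obtain x where "x \<in> M" by fastforce
  then show ?case by (intro exI[of _ "\<lambda>_. 1"]) auto
next
  case (insert j J)
  show ?case
  proof (cases "\<forall>x\<in>M. a x j = 0")
    case True
    have "card J < card M" using insert by simp
    from insert.IH[OF insert.prems(1) this, of a] show ?thesis using True by auto
  next
    case False
    then obtain y where y: "y \<in> M" "a y j \<noteq> 0" by auto
    define M' where "M' = M - {y}"
    have M': "finite M'" "card J < card M'" "y \<notin> M'" "M = insert y M'"
      using insert y unfolding M'_def by auto
    obtain c where c: "\<exists>x\<in>M'. c x \<noteq> 0"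
      "\<And>i. i \<in> J \<Longrightarrow> (\<Sum>x\<in>M'. c x * (a x i - a x j / a y j * a y i)) = 0"
      using insert.IH[OF M'(1,2), of "\<lambda>x i. a x i - a x j / a y j * a y i"] by blast
    \<comment> \<open>The value at \<open>y\<close> solves equation \<open>j\<close>; substituting
      it turns the remaining equations into the reduced system that \<open>c\<close>
      satisfies.\<close>
    define d where "d = c(y := - (\<Sum>x\<in>M'. c x * a x j) / a y j)"
    have d: "d x = c x" if "x \<in> M'" for x using that M'(3) unfolding d_def by auto
    have "(\<Sum>x\<in>M. d x * a x i) = (\<Sum>x\<in>M'. c x * (a x i - a x j / a y j * a y i))" for i
    proof -
      have "(\<Sum>x\<in>M. d x * a x i) = d y * a y i + (\<Sum>x\<in>M'. c x * a x i)"
        using M' d by simp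
      also have "d y * a y i = - (\<Sum>x\<in>M'. c x * (a x j / a y j * a y i))"
        unfolding d_def by (simp add: sum_divide_distrib sum_distrib_right mult.assoc)
      finally show ?thesis by (simp add: sum_subtractf right_diff_distrib)
    qed
    then have "(\<Sum>x\<in>M. d x * a x i) = 0" if "i \<in> insert j J" for i
      using c(2) that y(2) by auto
    moreover have "\<exists>x\<in>M. d x \<noteq> 0" using c(1) d M'(4) by auto
    ultimately show ?thesis by blast
  qed
qed

section \<open>Degrees in single variables, grids and algebraic dependence\<close>

definition upd :: "'a pt \<Rightarrow> nat \<times> nat \<times> nat \<Rightarrow> 'a \<Rightarrow> 'a pt" where
  "upd p x t = (\<lambda>i j l. if (i, j, l) = x then t else p i j l)"

text \<open>The degree is bounded in each variable separately, not in total: this is what vanishing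
  on a grid requires, and it makes sense for functions without choosing a representing
  polynomial.\<close>

definition deg_le :: "nat \<Rightarrow> ('a::comm_ring_1 pt \<Rightarrow> 'a) \<Rightarrow> bool" where
  "deg_le d f \<longleftrightarrow> (\<forall>p x. \<exists>P. degree P \<le> d \<and> (\<forall>t. f (upd p x t) = poly P t))"

lemma deg_le_const: "deg_le d (\<lambda>p. c)"
  unfolding deg_le_def by (intro allI exI[of _ "[:c:]"]) simp

lemma deg_le_add:
  assumes "deg_le d f" "deg_le d g"
  shows "deg_le d (\<lambda>p. f p + g p)"
  unfolding deg_le_def
proof (intro allI)
  fix p x
  obtain P Q where "degree P \<le> d" "degree Q \<le> d"
    "\<forall>t. f (upd p x t) = poly P t" "\<forall>t. g (upd p x t) = poly Q t"
    using assms unfolding deg_le_def by meson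
  then show "\<exists>P. degree P \<le> d \<and> (\<forall>t. f (upd p x t) + g (upd p x t) = poly P t)"
    by (intro exI[of _ "P + Q"]) (auto intro: degree_add_le)
qed

lemma deg_le_mult:
  assumes "deg_le d f" "deg_le e g"
  shows "deg_le (d + e) (\<lambda>p. f p * g p)"
  unfolding deg_le_def
proof (intro allI)
  fix p x
  obtain P Q where "degree P \<le> d" "degree Q \<le> e"
    "\<forall>t. f (upd p x t) = poly P t" "\<forall>t. g (upd p x t) = poly Q t"
    using assms unfolding deg_le_def by meson
  then show "\<exists>P. degree P \<le> d + e \<and> (\<forall>t. f (upd p x t) * g (upd p x t) = poly P t)"
    by (intro exI[of _ "P * Q"]) (auto intro: order_trans[OF degree_mult_le])
qed

lemma deg_le_mono: "deg_le d f \<Longrightarrow> d \<le> e \<Longrightarrow> deg_le e f"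
  unfolding deg_le_def by (meson order_trans)

lemma deg_le_sum: "(\<And>x. x \<in> A \<Longrightarrow> deg_le d (f x)) \<Longrightarrow> deg_le d (\<lambda>p. \<Sum>x\<in>A. f x p)"
  by (induction A rule: infinite_finite_induct) (simp_all add: deg_le_const deg_le_add)

lemma deg_le_power: "deg_le d f \<Longrightarrow> deg_le (e * d) (\<lambda>p. f p ^ e)"
  by (induction e) (simp_all add: deg_le_const deg_le_mult)

lemma deg_le_prod:
  "(\<And>x. x \<in> A \<Longrightarrow> deg_le d (f x)) \<Longrightarrow> deg_le (card A * d) (\<lambda>p. \<Prod>x\<in>A. f x p)"
  by (induction A rule: infinite_finite_induct) (simp_all add: deg_le_const deg_le_mult)

lemma polyfun_deg_le: "f \<in> polyfun \<Longrightarrow> \<exists>d. deg_le d f"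
proof (induction f rule: polyfun.induct)
  case (pf_const c)
  then show ?case using deg_le_const by blast
next
  case (pf_var i j l)
  have "deg_le 1 (\<lambda>p :: 'a pt. p i j l)"
    unfolding deg_le_def
  proof (intro allI)
    fix p :: "'a pt" and x
    show "\<exists>P. degree P \<le> 1 \<and> (\<forall>t. upd p x t i j l = poly P t)"
      by (cases "(i, j, l) = x"; intro exI[of _ "if (i, j, l) = x then [:0, 1:] else [:p i j l:]"])
         (auto simp: upd_def)
  qed
  then show ?case by blast
next
  case (pf_add f g)
  then obtain d e where "deg_le d f" "deg_le e g" by auto
  then have "deg_le (max d e) (\<lambda>p. f p + g p)"
    by (intro deg_le_add) (auto intro: deg_le_mono)
  then show ?case by blast
next
  case (pf_mult f g)
  then show ?case using deg_le_mult by blast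
qed

definition supp_in :: "(nat \<times> nat \<times> nat) set \<Rightarrow> 'a::zero pt set" where
  "supp_in A = {p. \<forall>i j l. (i, j, l) \<notin> A \<longrightarrow> p i j l = 0}"

lemma deg_le_zero_grid:
  fixes f :: "'a::idom pt \<Rightarrow> 'a"
  assumes "deg_le d f" "finite G" "d < card G" "finite I"
    and grid: "\<And>p. p \<in> supp_in I \<Longrightarrow> (\<And>i j l. (i, j, l) \<in> I \<Longrightarrow> p i j l \<in> G) \<Longrightarrow> f p = 0"
    and "p \<in> supp_in I"
  shows "f p = 0"
proof -
  \<comment> \<open>\<open>A\<close> is the set of coordinates already released from the grid.
    Releasing one more keeps \<open>f\<close> zero, because in that coordinate it is a polynomial of
    degree at most \<open>d\<close> with more than \<open>d\<close> zeros in
    \<open>G\<close>.\<close>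
  have "f p = 0" if "A \<subseteq> I" "p \<in> supp_in I" "\<And>i j l. (i, j, l) \<in> I - A \<Longrightarrow> p i j l \<in> G" for A p
    using finite_subset[OF that(1) assms(4)] that
  proof (induction A arbitrary: p rule: finite_induct)
    case empty
    then show ?case using grid by auto
  next
    case (insert x A)
    obtain P where P: "degree P \<le> d" "\<And>t. f (upd p x t) = poly P t"
      using assms(1) unfolding deg_le_def by meson
    have "poly P t = 0" if "t \<in> G" for t
    proof -
      have "f (upd p x t) = 0"
      proof (rule insert.IH)
        show "A \<subseteq> I" using insert.prems by simp
        show "upd p x t \<in> supp_in I"
          using insert.prems(1,2) unfolding supp_in_def upd_def by auto
        show "upd p x t i j l \<in> G" if "(i, j, l) \<in> I - A" for i j l
          using insert.prems(3)[of i j l] that \<open>t \<in> G\<close> unfolding upd_def by auto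
      qed
      then show ?thesis using P by simp
    qed
    then have sub: "G \<subseteq> {t. poly P t = 0}" by auto
    have "P = 0"
    proof (rule ccontr)
      assume "P \<noteq> 0"
      then have "card G \<le> degree P"
        using card_mono[OF poly_roots_finite[OF \<open>P \<noteq> 0\<close>] sub] card_poly_roots_bound[OF \<open>P \<noteq> 0\<close>]
        by linarith
      then show False using P(1) assms(3) by simp
    qed
    moreover have "p = upd p x (p (fst x) (fst (snd x)) (snd (snd x)))"
      unfolding upd_def by (intro ext) auto
    ultimately show ?case using P(2) by (metis poly_0)
  qed
  from this[of I p] show ?thesis using assms(6) by auto
qed

definition idx :: "nat \<Rightarrow> nat \<Rightarrow> nat \<Rightarrow> (nat \<times> nat \<times> nat) set" where
  "idx m n k = {..<m} \<times> {..<n} \<times> {..<k}"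

lemma idx_simps [simp]: "finite (idx m n k)" "card (idx m n k) = m * n * k"
  by (simp_all add: idx_def card_cartesian_product)

lemma mem_idx [simp]: "(i, j, l) \<in> idx m n k \<longleftrightarrow> i < m \<and> j < n \<and> l < k"
  by (simp add: idx_def)

lemma aff_eq_supp_in: "aff m n k = supp_in (idx m n k)"
  unfolding aff_def supp_in_def by (auto simp: not_less)

text \<open>There are $(D+1)^d$ monomials in the $f_i$ with exponents at most $D$, and it suffices to
  kill a linear combination of them on a grid with $O(D)^{mnk}$ points.\<close>
lemma polyfun_algebraic_dependence:
  fixes f :: "nat \<Rightarrow> 'a::alg_closed_field pt \<Rightarrow> 'a"
  assumes "\<And>i. i < d \<Longrightarrow> f i \<in> polyfun" "m * n * k < d"
  shows "\<exists>M c. finite M \<and> M \<noteq> {} \<and> (\<forall>\<alpha>\<in>M. c \<alpha> \<noteq> 0) \<and> M \<subseteq> extensional {..<d} \<and>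
    (\<forall>p\<in>aff m n k. (\<Sum>\<alpha>\<in>M. c \<alpha> * (\<Prod>i<d. f i p ^ \<alpha> i)) = 0)"
proof -
  define N where "N = m * n * k"
  have "\<forall>i\<in>{..<d}. \<exists>e. deg_le e (f i)" using assms(1) polyfun_deg_le by auto
  then obtain e where e: "\<And>i. i < d \<Longrightarrow> deg_le (e i) (f i)" by (metis lessThan_iff)
  define \<delta> where "\<delta> = (\<Sum>i<d. e i)"
  have fd: "deg_le \<delta> (f i)" if "i < d" for i
    using e[OF that] by (rule deg_le_mono) (use that in \<open>auto simp: \<delta>_def intro: member_le_sum\<close>)
  \<comment> \<open>This \<open>D\<close> absorbs the constant factor of the grid: \<open>(d * D *
    \<delta> + 1) ^ N \<le> (d * \<delta> + 1) ^ N * (D + 1) ^ N = D * (D + 1) ^ N\<close>, which is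
    less than \<open>(D + 1) ^ Suc N\<close>. Since \<open>N < d\<close>, there are at least that
    many exponent vectors.\<close>
  define D where "D = (d * \<delta> + 1) ^ N"
  define E where "E = ({..<d} \<rightarrow>\<^sub>E {..D})"
  obtain G :: "'a set" where G: "finite G" "card G = d * D * \<delta> + 1"
    using infinite_arbitrarily_large[OF infinite_UNIV_alg_closed] by blast
  have fin: "finite E" unfolding E_def by (intro finite_PiE) auto
  define Gr where "Gr = (idx m n k \<rightarrow>\<^sub>E G)"
  define ev where "ev h = (\<lambda>i j l. if (i, j, l) \<in> idx m n k then h (i, j, l) else 0)"
    for h :: "nat \<times> nat \<times> nat \<Rightarrow> 'a"
  have "card Gr = (d * D * \<delta> + 1) ^ N"
    unfolding Gr_def N_def by (simp add: card_funcsetE G)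
  also have "\<dots> \<le> ((d * \<delta> + 1) * (D + 1)) ^ N"
    by (intro power_mono) (auto simp: algebra_simps)
  also have "\<dots> = D * (D + 1) ^ N" by (simp only: power_mult_distrib D_def)
  also have "\<dots> < (D + 1) ^ Suc N" by simp
  also have "\<dots> \<le> (D + 1) ^ d" using assms(2) by (intro power_increasing) (auto simp: N_def)
  also have "\<dots> = card E" unfolding E_def by (simp add: card_funcsetE)
  finally have lt: "card Gr < card E" .
  have "finite Gr" unfolding Gr_def using G by (intro finite_PiE) auto
  from homogeneous_system_nontrivial[OF this fin lt, of "\<lambda>\<alpha> h. \<Prod>i<d. f i (ev h) ^ \<alpha> i"]
  obtain c where c: "\<exists>\<alpha>\<in>E. c \<alpha> \<noteq> 0"
    "\<And>h. h \<in> Gr \<Longrightarrow> (\<Sum>\<alpha>\<in>E. c \<alpha> * (\<Prod>i<d. f i (ev h) ^ \<alpha> i)) = 0" by blast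
  define F where "F = (\<lambda>p. \<Sum>\<alpha>\<in>E. c \<alpha> * (\<Prod>i<d. f i p ^ \<alpha> i))"
  have "deg_le (0 + card {..<d} * (D * \<delta>)) (\<lambda>p. c \<alpha> * (\<Prod>i<d. f i p ^ \<alpha> i))" if "\<alpha> \<in> E" for \<alpha>
  proof (rule deg_le_mult[OF deg_le_const deg_le_prod])
    fix i assume i: "i \<in> {..<d}"
    then have "\<alpha> i \<le> D" using that unfolding E_def by auto
    then show "deg_le (D * \<delta>) (\<lambda>p. f i p ^ \<alpha> i)"
      using deg_le_mono[OF deg_le_power[OF fd], of i "\<alpha> i" "D * \<delta>"] i by simp
  qed
  then have "deg_le (d * D * \<delta>) F" unfolding F_def
    by (intro deg_le_sum) (simp add: mult.assoc)
  then have F0: "F p = 0" if "p \<in> aff m n k" for p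
  proof (rule deg_le_zero_grid[of _ _ G "idx m n k"])
    show "p \<in> supp_in (idx m n k)" using that by (simp add: aff_eq_supp_in)
    fix p :: "'a pt"
    assume p: "p \<in> supp_in (idx m n k)" "\<And>i j l. (i, j, l) \<in> idx m n k \<Longrightarrow> p i j l \<in> G"
    define h where "h = restrict (\<lambda>(i, j, l). p i j l) (idx m n k)"
    have "h \<in> Gr" unfolding Gr_def h_def using p(2) by auto
    moreover have "ev h = p" using p(1) unfolding ev_def h_def supp_in_def by (intro ext) auto
    ultimately show "F p = 0" using c(2) unfolding F_def by metis
  qed (use G in auto)
  define M where "M = {\<alpha> \<in> E. c \<alpha> \<noteq> 0}"
  have "F p = (\<Sum>\<alpha>\<in>M. c \<alpha> * (\<Prod>i<d. f i p ^ \<alpha> i))" for p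
    unfolding F_def M_def using fin by (intro sum.mono_neutral_right) auto
  then have "\<forall>p\<in>aff m n k. (\<Sum>\<alpha>\<in>M. c \<alpha> * (\<Prod>i<d. f i p ^ \<alpha> i)) = 0" using F0 by simp
  moreover have "finite M" "M \<noteq> {}" "\<forall>\<alpha>\<in>M. c \<alpha> \<noteq> 0"
    using fin c(1) unfolding M_def by auto
  moreover have "M \<subseteq> extensional {..<d}" unfolding M_def E_def PiE_def by blast
  ultimately show ?thesis by blast
qed

text \<open>Dividing an algebraic relation on $C_{j+1}$ by the highest power of $f_j$ that occurs in all
  its terms gives a relation on $C_{j+1}$, since $C_{j+1}$ is irreducible; on $C_j$ the function
  $f_j$ is zero, and a nontrivial relation between $f_0,\dots,f_{j-1}$ remains.\<close>
lemma zirreducible_chain_length_le: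
  fixes C :: "nat \<Rightarrow> 'a::alg_closed_field pt set"
  assumes irr: "\<And>i. i \<le> d \<Longrightarrow> zirreducible m n k (C i)" and str: "\<And>i. i < d \<Longrightarrow> C i \<subset> C (Suc i)"
  shows "d \<le> m * n * k"
proof (rule ccontr)
  assume "\<not> d \<le> m * n * k"
  then have d: "m * n * k < d" by simp
  have closed: "zclosed m n k (C i)" if "i \<le> d" for i
    using irr[OF that] unfolding zirreducible_def by simp
  have "\<exists>f\<in>polyfun. (\<forall>p\<in>C i. f p = 0) \<and> (\<exists>p\<in>C (Suc i). f p \<noteq> 0)" if "i < d" for i
    using zclosed_strict_separation[OF closed str zclosed_subset_aff[OF closed]] that by auto
  then obtain f where f: "\<And>i. i < d \<Longrightarrow> f i \<in> polyfun"
    "\<And>i p. i < d \<Longrightarrow> p \<in> C i \<Longrightarrow> f i p = 0" "\<And>i. i < d \<Longrightarrow> \<exists>p\<in>C (Suc i). f i p \<noteq> 0" by metis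
  \<comment> \<open>Nontriviality is expressed by nonzero coefficients together with exponent
    vectors that differ already below \<open>j\<close>; their values from \<open>j\<close> on are
    irrelevant, so the vectors need not be truncated in the descent.\<close>
  define rel where "rel j M c \<longleftrightarrow> finite M \<and> M \<noteq> {} \<and> (\<forall>\<alpha>\<in>M. c \<alpha> \<noteq> 0) \<and>
    (\<forall>\<alpha>\<in>M. \<forall>\<beta>\<in>M. (\<forall>i<j. \<alpha> i = \<beta> i) \<longrightarrow> \<alpha> = \<beta>) \<and>
    (\<forall>p\<in>C j. (\<Sum>\<alpha>\<in>M. c \<alpha> * (\<Prod>i<j. f i p ^ \<alpha> i)) = 0)"
    for j and M :: "(nat \<Rightarrow> nat) set" and c
  have "\<exists>M c. rel (d - j) M c" if "j \<le> d" for j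
    using that
  proof (induction j)
    case 0
    obtain M c where "finite M" "M \<noteq> {}" "\<forall>\<alpha>\<in>M. c \<alpha> \<noteq> 0" and ext: "M \<subseteq> extensional {..<d}"
      and 0: "\<forall>p\<in>aff m n k. (\<Sum>\<alpha>\<in>M. c \<alpha> * (\<Prod>i<d. f i p ^ \<alpha> i)) = 0"
      using polyfun_algebraic_dependence[of d f m n k, OF f(1) d] by blast
    moreover have "\<alpha> = \<beta>" if "\<alpha> \<in> M" "\<beta> \<in> M" "\<forall>i<d. \<alpha> i = \<beta> i" for \<alpha> \<beta>
      using that ext by (intro extensionalityI[of \<alpha> "{..<d}"]) auto
    moreover have "C d \<subseteq> aff m n k" using closed zclosed_subset_aff by blast
    ultimately have "rel d M c" unfolding rel_def by blast
    then show ?case by auto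
  next
    case (Suc j)
    then obtain M c where "rel (d - j) M c" by auto
    define i where "i = d - Suc j"
    have i: "d - j = Suc i" "i < d" "d - Suc j = i" using Suc.prems by (auto simp: i_def)
    have M: "finite M" "M \<noteq> {}" "\<And>\<alpha>. \<alpha> \<in> M \<Longrightarrow> c \<alpha> \<noteq> 0"
      "\<And>\<alpha> \<beta>. \<alpha> \<in> M \<Longrightarrow> \<beta> \<in> M \<Longrightarrow> (\<forall>j<Suc i. \<alpha> j = \<beta> j) \<Longrightarrow> \<alpha> = \<beta>"
      "\<And>p. p \<in> C (Suc i) \<Longrightarrow> (\<Sum>\<alpha>\<in>M. c \<alpha> * (\<Prod>j<Suc i. f j p ^ \<alpha> j)) = 0"
      using \<open>rel (d - j) M c\<close> unfolding rel_def i(1) by auto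
    define e where "e = Min ((\<lambda>\<alpha>. \<alpha> i) ` M)"
    have e_le: "e \<le> \<alpha> i" if "\<alpha> \<in> M" for \<alpha> unfolding e_def using that M(1) by (intro Min_le) auto
    have "e \<in> (\<lambda>\<alpha>. \<alpha> i) ` M" unfolding e_def using M(1,2) by (intro Min_in) auto
    then obtain \<alpha>0 where \<alpha>0: "\<alpha>0 \<in> M" "\<alpha>0 i = e" by auto
    define g where "g = (\<lambda>p. \<Sum>\<alpha>\<in>M. c \<alpha> * (\<Prod>j<i. f j p ^ \<alpha> j) * f i p ^ (\<alpha> i - e))"
    have pow: "(\<lambda>p. h p ^ a) \<in> polyfun" if "h \<in> polyfun" for h :: "'a pt \<Rightarrow> 'a" and a
      using that by (induction a) (simp_all add: pf_const pf_mult)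
    have prd: "(\<lambda>p. \<Prod>j<i'. f j p ^ \<alpha> j) \<in> polyfun" if "i' \<le> d" for i' and \<alpha> :: "nat \<Rightarrow> nat"
      using that by (induction i') (simp_all add: pf_const pf_mult pow f(1))
    have g: "g \<in> polyfun" unfolding g_def using i(2) by (intro pf_sum pf_mult pf_const prd pow f(1)) auto
    have "f i p ^ e * g p = 0" if "p \<in> C (Suc i)" for p
    proof -
      have "f i p ^ e * g p = (\<Sum>\<alpha>\<in>M. c \<alpha> * (\<Prod>j<Suc i. f j p ^ \<alpha> j))"
        unfolding g_def sum_distrib_left
      proof (rule sum.cong[OF refl])
        fix \<alpha> assume "\<alpha> \<in> M"
        then have "f i p ^ \<alpha> i = f i p ^ e * f i p ^ (\<alpha> i - e)"
          using e_le by (simp flip: power_add)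
        then show "f i p ^ e * (c \<alpha> * (\<Prod>j<i. f j p ^ \<alpha> j) * f i p ^ (\<alpha> i - e)) =
          c \<alpha> * (\<Prod>j<Suc i. f j p ^ \<alpha> j)" by simp
      qed
      then show ?thesis using M(5)[OF that] by simp
    qed
    then have "(\<forall>p\<in>C (Suc i). f i p ^ e = 0) \<or> (\<forall>p\<in>C (Suc i). g p = 0)"
      using i(2) by (intro zirreducible_mult[OF irr pow g] f(1)) auto
    then have g0: "g p = 0" if "p \<in> C i" for p using f(3)[OF i(2)] str[OF i(2)] that by auto
    define M' where "M' = {\<alpha> \<in> M. \<alpha> i = e}"
    have "(\<Sum>\<alpha>\<in>M'. c \<alpha> * (\<Prod>j<i. f j p ^ \<alpha> j)) = 0" if "p \<in> C i" for p
    proof -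
      have "g p = (\<Sum>\<alpha>\<in>M'. c \<alpha> * (\<Prod>j<i. f j p ^ \<alpha> j) * f i p ^ (\<alpha> i - e))"
        unfolding g_def
      proof (rule sum.mono_neutral_right)
        show "\<forall>\<alpha>\<in>M - M'. c \<alpha> * (\<Prod>j<i. f j p ^ \<alpha> j) * f i p ^ (\<alpha> i - e) = 0"
        proof
          fix \<alpha> assume "\<alpha> \<in> M - M'"
          then have "\<alpha> i - e > 0" using e_le[of \<alpha>] unfolding M'_def by force
          then show "c \<alpha> * (\<Prod>j<i. f j p ^ \<alpha> j) * f i p ^ (\<alpha> i - e) = 0"
            using f(2)[OF i(2) that] by (simp add: power_0_left)
        qed
      qed (use M(1) in \<open>auto simp: M'_def\<close>)
      also have "\<dots> = (\<Sum>\<alpha>\<in>M'. c \<alpha> * (\<Prod>j<i. f j p ^ \<alpha> j))"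
        unfolding M'_def by (intro sum.cong) auto
      finally show ?thesis using g0[OF that] by simp
    qed
    moreover have "\<alpha> = \<beta>" if "\<alpha> \<in> M'" "\<beta> \<in> M'" "\<forall>j<i. \<alpha> j = \<beta> j" for \<alpha> \<beta>
      using that M(4)[of \<alpha> \<beta>] unfolding M'_def by (auto simp: less_Suc_eq)
    ultimately have "rel i M' c" unfolding rel_def using M(1,3) \<alpha>0 by (auto simp: M'_def)
    then show ?case using i(3) by auto
  qed
  \<comment> \<open>With no function left, all exponent vectors agree. The relation has one term and
    says that a nonzero constant vanishes at a point of \<open>C 0\<close>.\<close>
  from this[of d] obtain M c where M: "rel 0 M c" by auto
  obtain \<alpha> where "\<alpha> \<in> M" using M unfolding rel_def by auto
  moreover from this have "M = {\<alpha>}" using M unfolding rel_def by auto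
  moreover obtain p where "p \<in> C 0" using irr[of 0] unfolding zirreducible_def by auto
  ultimately show False using M unfolding rel_def by auto
qed

section \<open>Reading off the codimension from a chain of maximal length\<close>

definition zchain :: "nat \<Rightarrow> nat \<Rightarrow> nat \<Rightarrow> nat \<Rightarrow> 'a::comm_ring_1 pt set \<Rightarrow> 'a pt set \<Rightarrow> bool" where
  "zchain m n k d X Y \<longleftrightarrow> (\<exists>C. C 0 = X \<and> C d = Y \<and>
     (\<forall>i\<le>d. zirreducible m n k (C i)) \<and> (\<forall>i<d. C i \<subset> C (Suc i)))"

lemma zchain_refl: "zirreducible m n k X \<Longrightarrow> zchain m n k 0 X X"
  unfolding zchain_def by (intro exI[of _ "\<lambda>_. X"]) auto

lemma zchain_step: "zirreducible m n k X \<Longrightarrow> zirreducible m n k Y \<Longrightarrow> X \<subset> Y \<Longrightarrow> zchain m n k 1 X Y"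
  unfolding zchain_def by (intro exI[of _ "\<lambda>i. if i = 0 then X else Y"]) auto

lemma zchain_trans:
  assumes "zchain m n k d X Y" "zchain m n k e Y W"
  shows "zchain m n k (d + e) X W"
proof -
  obtain C D where C: "C 0 = X" "C d = Y" "\<forall>i\<le>d. zirreducible m n k (C i)" "\<forall>i<d. C i \<subset> C (Suc i)"
    and D: "D 0 = Y" "D e = W" "\<forall>i\<le>e. zirreducible m n k (D i)" "\<forall>i<e. D i \<subset> D (Suc i)"
    using assms unfolding zchain_def by metis
  define B where "B i = (if i \<le> d then C i else D (i - d))" for i
  have B: "B i = D (i - d)" if "d \<le> i" for i using that C(2) D(1) by (auto simp: B_def)
  have "B i \<subset> B (Suc i)" if "i < d + e" for i
  proof (cases "i < d")
    case True
    then show ?thesis using C(4) by (auto simp: B_def)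
  next
    case False
    then have "D (i - d) \<subset> D (Suc (i - d))" using D(4) that by auto
    then show ?thesis using False by (auto simp: B Suc_diff_le)
  qed
  moreover have "\<forall>i\<le>d + e. zirreducible m n k (B i)" using C(3) D(3) by (auto simp: B_def)
  moreover have "B 0 = X" "B (d + e) = W" using C(1) B[of "d + e"] D(2) by (auto simp: B_def)
  ultimately show ?thesis unfolding zchain_def by blast
qed

lemma zchain_length_le:
  fixes X Y :: "'a::alg_closed_field pt set"
  shows "zchain m n k d X Y \<Longrightarrow> d \<le> m * n * k"
  unfolding zchain_def using zirreducible_chain_length_le by metis

text \<open>A chain of any length \<open>e'\<close> above \<open>X\<close> can be appended to the
  one of length \<open>d\<close> below it, so \<open>d + e' \<le> m * n * k = d + e\<close>. The
  ends \<open>W\<close> and \<open>Y\<close> are arbitrary.\<close>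

lemma zcodim_eqI:
  fixes X Y W :: "'a::alg_closed_field pt set"
  assumes "zchain m n k d W X" "zchain m n k e X Y" "d + e = m * n * k"
  shows "zcodim m n k X = e"
proof -
  let ?S = "{d. \<exists>C :: nat \<Rightarrow> 'a pt set. C 0 = X \<and>
       (\<forall>i\<le>d. zirreducible m n k (C i)) \<and> (\<forall>i<d. C i \<subset> C (Suc i))}"
  have "e \<in> ?S" using assms(2) unfolding zchain_def by blast
  moreover have "e' \<le> e" if "e' \<in> ?S" for e'
  proof -
    obtain C where "zchain m n k e' X (C e')" using \<open>e' \<in> ?S\<close> unfolding zchain_def by blast
    then have "d + e' \<le> m * n * k" using zchain_trans[OF assms(1)] zchain_length_le by blast
    then show ?thesis using assms(3) by simp
  qed
  ultimately show ?thesis unfolding zcodim_def by (intro cSup_eq_maximum) auto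
qed

section \<open>Flags from polynomial parametrizations\<close>

lemma zirreducible_parametrized:
  fixes \<Phi> :: "'a::alg_closed_field pt \<Rightarrow> 'a pt"
  assumes "\<And>i j l. (\<lambda>q. \<Phi> q i j l) \<in> polyfun" "\<Phi> ` supp_in S \<subseteq> aff m n k"
  shows "zirreducible m n k (zclosure m n k (\<Phi> ` supp_in S))"
proof (rule zirreducible_zclosureI[OF assms(2)])
  have "(\<lambda>_ _ _. 0) \<in> supp_in S" unfolding supp_in_def by simp
  then show "\<Phi> ` supp_in S \<noteq> {}" by blast
  fix f g p q
  assume *: "f \<in> polyfun" "g \<in> polyfun" "p \<in> \<Phi> ` supp_in S" "q \<in> \<Phi> ` supp_in S"
    "f p \<noteq> 0" "g q \<noteq> 0"
  then obtain a b where ab: "a \<in> supp_in S" "p = \<Phi> a" "b \<in> supp_in S" "q = \<Phi> b" by auto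
  define c where "c t = (\<lambda>i j l. a i j l + t * (b i j l - a i j l))" for t
  have c: "c t \<in> supp_in S" for t using ab(1,3) unfolding c_def supp_in_def by auto
  have c01: "c 0 = a" "c 1 = b" unfolding c_def by auto
  have "is_poly (\<lambda>t. c t i j l)" for i j l
    unfolding c_def by (intro is_poly_add is_poly_mult is_poly_const is_poly_id)
  then have "is_poly (\<lambda>t. h (\<Phi> (c t)))" if "h \<in> polyfun" for h
    using is_poly_polyfun[where c = c, OF pf_comp[where \<Phi> = \<Phi>, OF that assms(1)]] by blast
  then obtain t where "f (\<Phi> (c t)) \<noteq> 0" "g (\<Phi> (c t)) \<noteq> 0"
    using is_poly_common_nonzero[of "\<lambda>t. f (\<Phi> (c t))" "\<lambda>t. g (\<Phi> (c t))" 0 1] * ab c01 by auto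
  then show "\<exists>r\<in>\<Phi> ` supp_in S. f r \<noteq> 0 \<and> g r \<noteq> 0" using c by blast
qed

definition ind_pt :: "(nat \<times> nat \<times> nat) set \<Rightarrow> 'a::zero_neq_one pt" where
  "ind_pt A = (\<lambda>i j l. if (i, j, l) \<in> A then 1 else 0)"

lemma supp_in_mono: "S \<subseteq> T \<Longrightarrow> supp_in S \<subseteq> supp_in T"
  unfolding supp_in_def by auto

text \<open>The parameters in \<open>T - S\<close> are switched on by increasing rank, ties in any
  order. The test \<open>g x\<close> vanishes while only other parameters of rank at most
  \<open>rk x\<close> are on, and is nonzero once \<open>x\<close> joins the base parameter
  \<open>b\<close>; hence each step is strict. \<open>b\<close> comes first because some parameters
  are invisible without it: \<open>u\<close> does not show in \<open>u v^T\<close> when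
  \<open>v = 0\<close>.\<close>

lemma zchain_flag:
  fixes \<Phi> :: "'a::alg_closed_field pt \<Rightarrow> 'a pt" and rk :: "nat \<times> nat \<times> nat \<Rightarrow> nat"
  assumes poly: "\<And>i j l. (\<lambda>q. \<Phi> q i j l) \<in> polyfun" and aff: "\<Phi> ` supp_in I \<subseteq> aff m n k"
    and rk_b: "\<And>x. x \<in> I \<Longrightarrow> x \<noteq> b \<Longrightarrow> rk b < rk x"
    and g: "\<And>x. x \<in> I \<Longrightarrow> g x \<in> polyfun"
    and g0: "\<And>x q. x \<in> I \<Longrightarrow> q \<in> supp_in {y \<in> I. rk y \<le> rk x \<and> y \<noteq> x} \<Longrightarrow> g x (\<Phi> q) = 0"
    and g1: "\<And>x. x \<in> I \<Longrightarrow> g x (\<Phi> (ind_pt {b, x})) \<noteq> 0"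
    and "finite I" "S \<subseteq> T" "T \<subseteq> I" "\<And>x y. x \<in> T - S \<Longrightarrow> y \<in> S \<Longrightarrow> rk y \<le> rk x" "b \<in> T \<or> T = S"
  shows "zchain m n k (card (T - S)) (zclosure m n k (\<Phi> ` supp_in S)) (zclosure m n k (\<Phi> ` supp_in T))"
proof -
  define D where "D A = zclosure m n k (\<Phi> ` supp_in A)" for A
  have aff': "\<Phi> ` supp_in A \<subseteq> aff m n k" if "A \<subseteq> I" for A
    using supp_in_mono[OF that] aff by blast
  have irr: "zirreducible m n k (D A)" if "A \<subseteq> I" for A
    unfolding D_def by (rule zirreducible_parametrized[OF poly aff'[OF that]])
  have "zchain m n k N (D S) (D T)"
    if "card (T - S) = N" "S \<subseteq> T" "T \<subseteq> I" "\<And>x y. x \<in> T - S \<Longrightarrow> y \<in> S \<Longrightarrow> rk y \<le> rk x"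
      "b \<in> T \<or> T = S" for N T
    using that
  proof (induction N arbitrary: T)
    case 0
    have "finite (T - S)" using 0 \<open>finite I\<close> by (meson finite_Diff finite_subset)
    then have "T = S" using 0 by auto
    then show ?case using zchain_refl[OF irr] 0 by auto
  next
    case (Suc N)
    have fin: "finite (T - S)" using Suc.prems(3) \<open>finite I\<close> by (meson finite_Diff finite_subset)
    have "T - S \<noteq> {}" using Suc.prems(1) by (metis card.empty nat.distinct(1))
    then have "Max (rk ` (T - S)) \<in> rk ` (T - S)" using fin by (intro Max_in) auto
    then obtain x where x: "x \<in> T - S" "rk x = Max (rk ` (T - S))" by auto
    then have x_max: "rk y \<le> rk x" if "y \<in> T - S" for y using that fin by simp
    define T' where "T' = T - {x}"
    have T: "T = insert x T'" "x \<notin> T'" "S \<subseteq> T'" "T' \<subseteq> I" "x \<in> I"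
      using x(1) Suc.prems(2,3) by (auto simp: T'_def)
    have le: "rk y \<le> rk x" if "y \<in> T'" for y
      using that x(1) x_max Suc.prems(4) by (cases "y \<in> S") (auto simp: T'_def)
    have b: "b \<in> T" using Suc.prems(5) x(1) by auto
    \<comment> \<open>If the removed parameter is \<open>b\<close> itself, nothing else can be on,
      since \<open>b\<close> has strictly the least rank; then \<open>T'\<close> and
      \<open>S\<close> are both empty.\<close>
    have b': "b \<in> T' \<or> T' = S"
    proof (cases "x = b")
      case True
      have "T' = {}" using le rk_b T True by (metis all_not_in_conv leD subsetD)
      then show ?thesis using T(3) by auto
    qed (use b in \<open>auto simp: T'_def\<close>)
    have "card (T' - S) = N"
    proof -
      have "T - S = insert x (T' - S)" using x(1) by (auto simp: T'_def)
      then show ?thesis using Suc.prems(1) fin T(2) by simp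
    qed
    then have 1: "zchain m n k N (D S) (D T')"
      using b' T(3,4) Suc.prems(4) by (intro Suc.IH) (auto simp: T'_def)
    have "D T' \<subset> D T"
    proof
      have "\<Phi> ` supp_in T' \<subseteq> \<Phi> ` supp_in T" using T(1) by (intro image_mono supp_in_mono) auto
      also have "\<dots> \<subseteq> zclosure m n k (\<Phi> ` supp_in T)" by (rule subset_zclosure)
      finally show "D T' \<subseteq> D T" unfolding D_def
        by (rule zclosure_minimal[OF zclosed_zclosure[OF aff'[OF Suc.prems(3)]]])
      have "g x r = 0" if "r \<in> D T'" for r
      proof (rule polyfun_zero_zclosure[OF aff'[OF T(4)] g[OF T(5)]])
        show "r \<in> zclosure m n k (\<Phi> ` supp_in T')" using that by (simp add: D_def)
        have "supp_in T' \<subseteq> supp_in {y \<in> I. rk y \<le> rk x \<and> y \<noteq> x}"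
          using T le by (intro supp_in_mono) auto
        then show "g x q = 0" if "q \<in> \<Phi> ` supp_in T'" for q using g0[OF T(5)] that by blast
      qed
      moreover have "ind_pt {b, x} \<in> supp_in T"
        using b T unfolding supp_in_def ind_pt_def by auto
      then have "\<Phi> (ind_pt {b, x}) \<in> D T" unfolding D_def using subset_zclosure by blast
      ultimately show "D T' \<noteq> D T" using g1[OF T(5)] by auto
    qed
    then have "zchain m n k 1 (D T') (D T)"
      using irr T(4) Suc.prems(3) by (intro zchain_step) auto
    from zchain_trans[OF 1 this] show ?case by simp
  qed
  note main = this
  show ?thesis
    unfolding D_def[symmetric] by (rule main[OF refl assms(8,9) _ assms(11)]) (rule assms(10))
qed

section \<open>Jets of matrices of rank at most one\<close>

lemma coeff_xpoly: "coeff (xpoly k p i j) l = (if l < k then p i j l else 0)"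
  unfolding xpoly_def coeff_sum by (simp add: coeff_monom)

text \<open>For points of affine space this is the entry of \<open>X(t)\<close> without its terms
  below \<open>t^s\<close>, divided by \<open>t^s\<close>.\<close>

definition ser :: "nat \<Rightarrow> nat \<Rightarrow> 'a::comm_ring_1 pt \<Rightarrow> nat \<Rightarrow> nat \<Rightarrow> 'a poly" where
  "ser k s p i j = xpoly k (\<lambda>i j l. p i j (s + l)) i j"

lemma coeff_ser: "p \<in> aff m n k \<Longrightarrow> coeff (ser k s p i j) l = p i j (s + l)"
proof -
  assume "p \<in> aff m n k"
  then have "p i j (s + l) = 0" if "k \<le> l" using that unfolding aff_def by simp
  then show ?thesis unfolding ser_def coeff_xpoly by simp
qed

lemma permutes_lessThan_2: "{\<sigma>. \<sigma> permutes {..<2::nat}} = {id, Transposition.transpose 0 1}"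
proof -
  have "{..<2::nat} = {0, 1}" by auto
  then show ?thesis by (auto simp: permutes_doubleton_iff)
qed

definition minor2 :: "nat \<Rightarrow> 'a::comm_ring_1 pt \<Rightarrow> nat \<Rightarrow> nat \<Rightarrow> nat \<Rightarrow> nat \<Rightarrow> 'a poly" where
  "minor2 k p i i' j j' = xpoly k p i j * xpoly k p i' j' - xpoly k p i j' * xpoly k p i' j"

lemma Leibniz_minor2:
  "(\<Sum>\<sigma> | \<sigma> permutes {..<2::nat}. of_int (sign \<sigma>) * (\<Prod>i<2. xpoly k p (\<rho> i) (\<gamma> (\<sigma> i)))) =
    minor2 k p (\<rho> 0) (\<rho> 1) (\<gamma> 0) (\<gamma> 1)"
proof -
  have "id \<noteq> Transposition.transpose 0 (1::nat)"
    by (metis id_apply transpose_apply_first zero_neq_one)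
  then show ?thesis
    unfolding permutes_lessThan_2 minor2_def
    by (simp add: sign_swap_id sign_id numeral_2_eq_2 lessThan_Suc mult.commute)
qed

lemma Zlocus_2_iff:
  "p \<in> Zlocus m n 2 k \<longleftrightarrow> p \<in> aff m n k \<and>
    (\<forall>i<m. \<forall>i'<m. \<forall>j<n. \<forall>j'<n. monom 1 k dvd minor2 k p i i' j j')"
proof -
  have inj2: "inj_on \<rho> {..<2::nat} \<longleftrightarrow> \<rho> 0 \<noteq> \<rho> 1" for \<rho> :: "nat \<Rightarrow> nat"
    by (auto simp: inj_on_def numeral_2_eq_2 less_Suc_eq)
  have img2: "\<rho> ` {..<2::nat} \<subseteq> {..<N} \<longleftrightarrow> \<rho> 0 < N \<and> \<rho> 1 < N" for \<rho> :: "nat \<Rightarrow> nat" and N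
    by (auto simp: numeral_2_eq_2 less_Suc_eq)
  have deg: "minor2 k p i i j j' = 0" "minor2 k p i i' j j = 0" for i i' j j'
    by (simp_all add: minor2_def)
  show ?thesis
    unfolding Zlocus_def mem_Collect_eq Leibniz_minor2 inj2 img2 monom_1_dvd_iff'
  proof (intro conj_cong refl iffI allI impI)
    fix i i' j j' l
    assume *: "\<forall>(\<rho> :: nat \<Rightarrow> nat) (\<gamma> :: nat \<Rightarrow> nat). \<rho> 0 \<noteq> \<rho> 1 \<and> (\<rho> 0 < m \<and> \<rho> 1 < m) \<and> \<gamma> 0 \<noteq> \<gamma> 1 \<and> \<gamma> 0 < n \<and> \<gamma> 1 < n \<longrightarrow>
      (\<forall>l<k. coeff (minor2 k p (\<rho> 0) (\<rho> 1) (\<gamma> 0) (\<gamma> 1)) l = 0)"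
      "i < m" "i' < m" "j < n" "j' < n" "l < k"
    show "coeff (minor2 k p i i' j j') l = 0"
      using *(1)[THEN spec, THEN spec, of "\<lambda>a. if a = 0 then i else i'" "\<lambda>a. if a = 0 then j else j'"] *(2-)
      by (cases "i = i' \<or> j = j'") (auto simp: deg)
  next
    fix \<rho> \<gamma> :: "nat \<Rightarrow> nat" and l
    assume "\<forall>i<m. \<forall>i'<m. \<forall>j<n. \<forall>j'<n. \<forall>l<k. coeff (minor2 k p i i' j j') l = 0"
      "\<rho> 0 \<noteq> \<rho> 1 \<and> (\<rho> 0 < m \<and> \<rho> 1 < m) \<and> \<gamma> 0 \<noteq> \<gamma> 1 \<and> \<gamma> 0 < n \<and> \<gamma> 1 < n" "l < k"
    then show "coeff (minor2 k p (\<rho> 0) (\<rho> 1) (\<gamma> 0) (\<gamma> 1)) l = 0" by blast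
  qed
qed

section \<open>Order of a jet and factorization as a column times a row\<close>

definition Yloc :: "nat \<Rightarrow> nat \<Rightarrow> nat \<Rightarrow> nat \<Rightarrow> 'a::comm_ring_1 pt set" where
  "Yloc m n k s = {p \<in> Zlocus m n 2 k. \<forall>i<m. \<forall>j<n. \<forall>l<s. p i j l = 0}"

lemma pf_coeff_xpoly: "(\<lambda>p. coeff (xpoly k p i j) l) \<in> polyfun"
  by (cases "l < k") (simp_all add: coeff_xpoly pf_const pf_var)

lemma pf_coeff_mult:
  assumes "\<And>l. (\<lambda>p. coeff (P p) l) \<in> polyfun" "\<And>l. (\<lambda>p. coeff (Q p) l) \<in> polyfun"
  shows "(\<lambda>p. coeff (P p * Q p) l) \<in> polyfun"
  unfolding coeff_mult by (rule pf_sum) (rule pf_mult[OF assms(1) assms(2)])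

lemma pf_coeff_minor2: "(\<lambda>p. coeff (minor2 k p i i' j j') l) \<in> polyfun"
  unfolding minor2_def coeff_diff
  by (rule pf_diff[OF pf_coeff_mult[OF pf_coeff_xpoly pf_coeff_xpoly]
        pf_coeff_mult[OF pf_coeff_xpoly pf_coeff_xpoly]])

lemma zclosed_Yloc: "zclosed m n k (Yloc m n k s)"
proof -
  define P where "P = {\<lambda>p. coeff (minor2 k p i i' j j') l | i i' j j' l. i < m \<and> i' < m \<and> j < n \<and> j' < n \<and> l < k}
    \<union> {\<lambda>p. p i j l :: 'a | i j l. i < m \<and> j < n \<and> l < s}"
  have "P \<subseteq> polyfun" unfolding P_def by (auto intro: pf_var pf_coeff_minor2)
  moreover have "Yloc m n k s = {p \<in> aff m n k. \<forall>f\<in>P. f p = 0}"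
    unfolding Yloc_def Zlocus_2_iff P_def monom_1_dvd_iff' by fast
  ultimately show ?thesis unfolding zclosed_def by blast
qed

lemma Yloc_subset_aff: "Yloc m n k s \<subseteq> aff m n k"
  unfolding Yloc_def Zlocus_2_iff by blast

text \<open>That is, \<open>X(t)\<close> is \<open>t^s u v^T\<close> modulo
  \<open>t^(k - s)\<close>. The congruence stops at \<open>k - s\<close> rather than
  \<open>k\<close> because a \<open>2 \<times> 2\<close> minor multiplies an error of order
  \<open>k - s\<close> by another entry, which is divisible by \<open>t^s\<close>.\<close>

definition rk1 :: "nat \<Rightarrow> nat \<Rightarrow> nat \<Rightarrow> nat \<Rightarrow> (nat \<Rightarrow> 'a::comm_ring_1 poly) \<Rightarrow> (nat \<Rightarrow> 'a poly) \<Rightarrow> 'a pt \<Rightarrow> bool" where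
  "rk1 m n k s u v p \<longleftrightarrow> p \<in> aff m n k \<and> (\<forall>i<m. \<forall>j<n. (\<forall>l<s. p i j l = 0) \<and>
     (\<forall>l. s \<le> l \<and> l < k - s \<longrightarrow> p i j l = coeff (u i * v j) (l - s)))"

lemma rk1_xpoly:
  assumes "rk1 m n k s u v p" "2 * s \<le> k"
  shows "\<exists>R. \<forall>i<m. \<forall>j<n. xpoly k p i j = monom 1 s * (u i * v j + monom 1 (k - 2 * s) * R i j)"
proof -
  have "monom 1 (k - s) dvd xpoly k p i j - monom 1 s * (u i * v j)" if "i < m" "j < n" for i j
    unfolding monom_1_dvd_iff' using assms that
    by (auto simp: rk1_def coeff_xpoly coeff_monom_mult)
  then have "\<forall>i j. \<exists>R. i < m \<and> j < n \<longrightarrow> xpoly k p i j - monom 1 s * (u i * v j) = monom 1 (k - s) * R"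
    by (meson dvdE)
  then obtain R where R: "\<And>i j. i < m \<Longrightarrow> j < n \<Longrightarrow> xpoly k p i j - monom 1 s * (u i * v j) = monom 1 (k - s) * R i j"
    by metis
  have "s + (k - 2 * s) = k - s" using assms(2) by simp
  then have "monom 1 (k - s) = monom 1 s * monom (1::'a) (k - 2 * s)" by (simp add: mult_monom)
  then have "xpoly k p i j = monom 1 s * (u i * v j + monom 1 (k - 2 * s) * R i j)" if "i < m" "j < n" for i j
    using R[OF that] by (simp add: algebra_simps)
  then show ?thesis by blast
qed

text \<open>The minors of \<open>u v^T\<close> cancel, so those of \<open>u v^T + E R\<close> are
  divisible by \<open>E\<close>; the factor \<open>t^s\<close> of each entry contributes
  \<open>t^(2 * s)\<close>, and \<open>t^(2 * s) * E = t^k\<close>.\<close>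

lemma rk1_imp_Yloc:
  assumes "rk1 m n k s u v p" "2 * s \<le> k"
  shows "p \<in> Yloc m n k s"
proof -
  define T E where "T = monom (1::'a) s" "E = monom (1::'a) (k - 2 * s)"
  obtain R where R: "\<And>i j. i < m \<Longrightarrow> j < n \<Longrightarrow> xpoly k p i j = T * (u i * v j + E * R i j)"
    using rk1_xpoly[OF assms] unfolding T_E_def by blast
  have k: "monom 1 k = T * T * E" using assms(2) by (simp add: T_E_def mult_monom)
  have "monom 1 k dvd minor2 k p i i' j j'" if "i < m" "i' < m" "j < n" "j' < n" for i i' j j'
  proof (rule dvdI)
    show "minor2 k p i i' j j' = monom 1 k * (u i * v j * R i' j' + u i' * v j' * R i j
      - u i * v j' * R i' j - u i' * v j * R i j' + E * (R i j * R i' j' - R i j' * R i' j))"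
      unfolding minor2_def k using that by (simp add: R algebra_simps)
  qed
  then show ?thesis using assms(1) unfolding Yloc_def Zlocus_2_iff rk1_def by blast
qed

text \<open>The inverse is built coefficient by coefficient: the constant \<open>C\<close> is chosen
  so that subtracting \<open>monom 1 e * C\<close> from \<open>b\<close> cancels the error at
  \<open>t^e\<close>.\<close>

lemma inverse_mod_monom:
  fixes a :: "'a::field poly"
  assumes "coeff a 0 \<noteq> 0"
  shows "\<exists>b. monom 1 e dvd a * b - 1"
proof (induction e)
  case (Suc e)
  then obtain b r where b: "a * b - 1 = monom 1 e * r" by (auto elim: dvdE)
  define C where "C = [:coeff r 0 / coeff a 0:]"
  have "coeff (r - C * a) 0 = 0" using assms by (simp add: C_def)
  then have "monom 1 1 dvd r - C * a" unfolding monom_1_dvd_iff' by simp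
  then have "monom 1 e * monom 1 1 dvd monom 1 e * (r - C * a)" by (rule mult_dvd_mono[OF dvd_refl])
  moreover have "monom 1 e * (r - C * a) = a * (b - monom 1 e * C) - 1"
    using b by (simp add: algebra_simps)
  ultimately show ?case by (intro exI[of _ "b - monom 1 e * C"]) (simp add: mult_monom)
qed simp

text \<open>After division by \<open>t^s\<close> the entry \<open>S a c\<close> is a unit, and the
  minors of \<open>S\<close> vanish modulo \<open>t^(k - 2 * s)\<close>. Hence \<open>S i j\<close>
  is congruent to \<open>S i c * (S a c)^-1 * S a j\<close>: column \<open>c\<close>, rescaled,
  times row \<open>a\<close>.\<close>

lemma Yloc_imp_rk1:
  fixes p :: "'a::field pt"
  assumes "p \<in> Yloc m n k s" "2 * s \<le> k" "a < m" "c < n" "p a c s \<noteq> 0"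
  shows "\<exists>u v. rk1 m n k s u v p"
proof -
  have p: "p \<in> aff m n k" using assms(1) Yloc_subset_aff by blast
  define S where "S = ser k s p"
  have S: "coeff (S i j) l = p i j (s + l)" for i j l
    unfolding S_def by (rule coeff_ser[OF p])
  have xS: "xpoly k p i j = monom 1 s * S i j" if "i < m" "j < n" for i j
    using assms(1) that p
    by (intro poly_eqI) (auto simp: coeff_xpoly coeff_monom_mult S Yloc_def aff_def)
  define E where "E = monom (1::'a) (k - 2 * s)"
  obtain b where b: "E dvd S a c * b - 1"
    using inverse_mod_monom[of "S a c"] assms(5) unfolding E_def S by auto
  define u v where "u i = S i c * b" and "v j = S a j" for i j
  have "E dvd S i j - u i * v j" if "i < m" "j < n" for i j
  proof -
    have "monom 1 k = monom 1 (2 * s) * E" using assms(2) by (simp add: E_def mult_monom)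
    moreover have "monom 1 k dvd minor2 k p i a j c"
      using assms(1,3,4) that unfolding Yloc_def Zlocus_2_iff by blast
    moreover have "monom (1::'a) (2 * s) = monom 1 s * monom 1 s" by (simp add: mult_monom mult_2)
    then have "minor2 k p i a j c = monom 1 (2 * s) * (S i j * S a c - S i c * S a j)"
      unfolding minor2_def using that assms(3,4)
      by (simp only: xS) (simp add: algebra_simps)
    ultimately have "E dvd S i j * S a c - S i c * S a j" by simp
    then have "E dvd b * (S i j * S a c - S i c * S a j) - S i j * (S a c * b - 1)"
      by (rule dvd_diff[OF dvd_mult dvd_mult[OF b]])
    then show ?thesis by (simp add: u_def v_def algebra_simps)
  qed
  then have eq: "p i j (s + l) = coeff (u i * v j) l" if "i < m" "j < n" "l < k - 2 * s" for i j l
    using that unfolding E_def monom_1_dvd_iff' coeff_diff S by auto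
  have "p i j l = coeff (u i * v j) (l - s)" if "i < m" "j < n" "s \<le> l" "l < k - s" for i j l
    using eq[of i j "l - s"] that by simp
  then have "rk1 m n k s u v p" using p assms(1) unfolding rk1_def Yloc_def by auto
  then show ?thesis by blast
qed

text \<open>With $u_0 = 1$, $u_i = \sum_b q_{i,0}^{(s+b)} t^b$ and $v_j = \sum_b q_{0,j}^{(s+b)} t^b$,
  the coefficients of $t^l$, $s \le l < k - s$, of the matrix with jet $\Phi(q)$ are those of
  $t^s u_i v_j$, perturbed by $q_{i,j}^{(l)}$ for $i, j \ge 1$; the other coefficients are free.\<close>
definition jet_param :: "nat \<Rightarrow> nat \<Rightarrow> 'a::comm_ring_1 pt \<Rightarrow> 'a pt" where
  "jet_param k s q = (\<lambda>i j l. if l < s \<or> k - s \<le> l \<or> i = 0 then q i j l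
     else (\<Sum>a\<le>l - s. q i 0 (s + a) * q 0 j (l - a)) + (if j = 0 then 0 else q i j l))"

text \<open>Row 0 carries \<open>v\<close>, the rest of column 0 carries \<open>u\<close>, and the
  levels from \<open>k - s\<close> on are free. Left off are the perturbations
  \<open>e_(i,j)\<close> of the product and the coefficients below \<open>t^s\<close>.\<close>

definition jet_idx :: "nat \<Rightarrow> nat \<Rightarrow> nat \<Rightarrow> nat \<Rightarrow> (nat \<times> nat \<times> nat) set" where
  "jet_idx m n k s = {(i, j, l) \<in> idx m n k. s \<le> l \<and> (k - s \<le> l \<or> i = 0 \<or> j = 0)}"

definition Vloc :: "nat \<Rightarrow> nat \<Rightarrow> nat \<Rightarrow> nat \<Rightarrow> 'a::comm_ring_1 pt set" where
  "Vloc m n k s = zclosure m n k (jet_param k s ` supp_in (jet_idx m n k s))"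

lemma jet_idx_subset: "jet_idx m n k s \<subseteq> idx m n k"
  unfolding jet_idx_def by auto

lemma pf_jet_param: "(\<lambda>q. jet_param k s q i j l) \<in> polyfun"
  unfolding jet_param_def
  by (cases "l < s \<or> k - s \<le> l \<or> i = 0"; cases "j = 0")
     (auto intro!: pf_add pf_sum pf_mult pf_var)

lemma jet_param_aff:
  assumes "q \<in> aff m n k" "0 < m" "0 < n"
  shows "jet_param k s q \<in> aff m n k"
proof -
  have q: "q i j l = 0" if "m \<le> i \<or> n \<le> j \<or> k \<le> l" for i j l
    using assms(1) that unfolding aff_def by blast
  have "jet_param k s q i j l = 0" if "m \<le> i \<or> n \<le> j \<or> k \<le> l" for i j l
    using that assms(2,3) unfolding jet_param_def by (auto simp: q)
  then show ?thesis unfolding aff_def by blast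
qed

lemma jet_param_image_aff:
  assumes "0 < m" "0 < n" "S \<subseteq> idx m n k"
  shows "jet_param k s ` supp_in S \<subseteq> aff m n k"
  using jet_param_aff[OF _ assms(1,2)] supp_in_mono[OF assms(3)] unfolding aff_eq_supp_in by blast

lemma zirreducible_Vloc:
  "0 < m \<Longrightarrow> 0 < n \<Longrightarrow> zirreducible m n k (Vloc m n k s :: 'a::alg_closed_field pt set)"
  unfolding Vloc_def
  by (intro zirreducible_parametrized pf_jet_param jet_param_image_aff jet_idx_subset)

lemma jet_param_coeff:
  assumes "q \<in> aff m n k" "s \<le> l" "l < k - s" "0 < i"
  shows "jet_param k s q i j l =
    coeff (ser k s q i 0 * ser k s q 0 j) (l - s) + (if j = 0 then 0 else q i j l)"
proof -
  have "coeff (ser k s q i 0 * ser k s q 0 j) (l - s) = (\<Sum>a\<le>l - s. q i 0 (s + a) * q 0 j (l - a))"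
    unfolding coeff_mult coeff_ser[OF assms(1)] using assms(2) by (intro sum.cong) auto
  then show ?thesis using assms(2-) unfolding jet_param_def by simp
qed

lemma jet_param_rk1:
  assumes "q \<in> supp_in (jet_idx m n k s)" "0 < m" "0 < n"
  shows "rk1 m n k s (\<lambda>i. if i = 0 then 1 else ser k s q i 0) (\<lambda>j. ser k s q 0 j) (jet_param k s q)"
proof -
  have q: "q \<in> aff m n k" using assms(1) supp_in_mono[OF jet_idx_subset] aff_eq_supp_in by blast
  have 0: "q i j l = 0" if "l < s \<or> l < k - s \<and> i \<noteq> 0 \<and> j \<noteq> 0" for i j l
    using assms(1) that unfolding supp_in_def jet_idx_def by auto
  have "jet_param k s q i j l = 0" if "l < s" for i j l
    using 0 that unfolding jet_param_def by simp
  moreover have "jet_param k s q i j l = coeff ((if i = 0 then 1 else ser k s q i 0) * ser k s q 0 j) (l - s)"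
    if "s \<le> l" "l < k - s" for i j l
  proof (cases "i = 0")
    case True
    then show ?thesis using that by (simp add: jet_param_def coeff_ser[OF q])
  next
    case False
    then show ?thesis using that 0 jet_param_coeff[OF q that] by simp
  qed
  ultimately show ?thesis unfolding rk1_def using jet_param_aff[OF q assms(2,3)] by blast
qed

text \<open>When \<open>u 0\<close> is a unit, \<open>u\<close> can be divided by it and
  \<open>v\<close> multiplied by it, which gives the normalization \<open>u 0 = 1\<close>.\<close>

lemma rk1_in_jet_param_image:
  fixes p :: "'a::field pt"
  assumes "rk1 m n k s u v p" "coeff (u 0) 0 \<noteq> 0" "0 < m" "0 < n"
  shows "p \<in> jet_param k s ` supp_in (jet_idx m n k s)"
proof -
  have p: "p \<in> aff m n k" and low: "\<And>i j l. i < m \<Longrightarrow> j < n \<Longrightarrow> l < s \<Longrightarrow> p i j l = 0"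
    and mid: "\<And>i j l. i < m \<Longrightarrow> j < n \<Longrightarrow> s \<le> l \<Longrightarrow> l < k - s \<Longrightarrow> p i j l = coeff (u i * v j) (l - s)"
    using assms(1) unfolding rk1_def by auto
  define E where "E = monom (1::'a) (k - 2 * s)"
  obtain b where b: "E dvd u 0 * b - 1" using inverse_mod_monom[OF assms(2)] unfolding E_def by blast
  \<comment> \<open>Row 0 is copied from \<open>p\<close>, where it is already
    \<open>u 0 * v j\<close>. Column 0 receives \<open>u i / u 0\<close>, with \<open>b\<close> as
    the inverse modulo \<open>t^(k - 2 * s)\<close>.\<close>
  define q where "q i j l =
    (if m \<le> i \<or> n \<le> j \<or> l < s then 0 else if k - s \<le> l \<or> i = 0 then p i j l
     else if j = 0 then coeff (u i * b) (l - s) else 0)" for i j l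
  have "q \<in> supp_in (jet_idx m n k s)"
    using p assms(3,4) unfolding supp_in_def jet_idx_def q_def aff_def by auto
  then have "q \<in> aff m n k" using supp_in_mono[OF jet_idx_subset] aff_eq_supp_in by blast
  then have aff: "jet_param k s q \<in> aff m n k" using jet_param_aff assms(3,4) by blast
  have "jet_param k s q i j l = p i j l" if ij: "i < m" "j < n" for i j l
  proof (cases "l < s \<or> k - s \<le> l \<or> i = 0")
    case True
    then show ?thesis using ij low unfolding jet_param_def q_def by auto
  next
    case False
    have "E dvd u i * v j * (u 0 * b - 1)" using b by simp
    moreover have "u i * v j * (u 0 * b - 1) = (u i * b) * (u 0 * v j) - u i * v j"
      by (simp add: algebra_simps)
    ultimately have "coeff ((u i * b) * (u 0 * v j)) (l - s) = coeff (u i * v j) (l - s)"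
      using False unfolding E_def monom_1_dvd_iff' by auto
    moreover have "coeff ((u i * b) * (u 0 * v j)) (l - s) =
      (\<Sum>a\<le>l - s. q i 0 (s + a) * q 0 j (l - a))"
      unfolding coeff_mult[of "u i * b"]
    proof (rule sum.cong[OF refl])
      fix a assume "a \<in> {..l - s}"
      then have a: "s + a < k - s" "s \<le> l - a" "l - a < k - s" "l - a - s = l - s - a"
        using False by auto
      then show "coeff (u i * b) a * coeff (u 0 * v j) (l - s - a) = q i 0 (s + a) * q 0 j (l - a)"
        using ij assms(3,4) False mid[of 0 j "l - a"] by (simp add: q_def)
    qed
    moreover have "(if j = 0 then 0 else q i j l) = 0" using False by (simp add: q_def)
    ultimately show ?thesis using False mid[OF ij] unfolding jet_param_def by simp
  qed
  moreover have "jet_param k s q i j l = p i j l" if "\<not> (i < m \<and> j < n)" for i j l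
  proof -
    have "m \<le> i \<or> n \<le> j" using that by auto
    then have "p i j l = 0" "jet_param k s q i j l = 0" using aff p unfolding aff_def by blast+
    then show ?thesis by simp
  qed
  ultimately have "jet_param k s q = p" by (intro ext) blast
  then show ?thesis using \<open>q \<in> supp_in (jet_idx m n k s)\<close> by blast
qed

text \<open>If \<open>u 0\<close> is not a unit, the scalar \<open>t\<close> is added to it. The jet
  then moves on a line, is in the image unless \<open>t\<close> is minus the constant term of
  \<open>u 0\<close>, and reaches \<open>p\<close> at \<open>t = 0\<close>.\<close>

lemma rk1_in_Vloc:
  fixes p :: "'a::alg_closed_field pt"
  assumes "rk1 m n k s u v p" "0 < m" "0 < n"
  shows "p \<in> Vloc m n k s"
proof -
  define c where "c t = (\<lambda>i j l. p i j l + t * (if i = 0 \<and> j < n \<and> s \<le> l \<and> l < k - s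
    then coeff (v j) (l - s) else 0))" for t
  have c0: "c 0 = p" unfolding c_def by simp
  have p: "p \<in> aff m n k" using assms(1) unfolding rk1_def by blast
  have "rk1 m n k s (u(0 := u 0 + [:t:])) v (c t)" for t
    using assms unfolding rk1_def c_def aff_def by (auto simp: algebra_simps)
  then have *: "c t \<in> jet_param k s ` supp_in (jet_idx m n k s)" if "t \<notin> {- coeff (u 0) 0}" for t
    by (rule rk1_in_jet_param_image)
       (use assms that in \<open>auto simp: eq_neg_iff_add_eq_0 add.commute\<close>)
  have "c 0 \<in> Vloc m n k s"
    unfolding Vloc_def
  proof (rule zclosure_curve)
    show "is_poly (\<lambda>t. c t i j l)" for i j l
      unfolding c_def by (intro is_poly_add is_poly_mult is_poly_const is_poly_id)
    show "finite {- coeff (u 0) 0}" by simp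
    show "c 0 \<in> aff m n k" using p c0 by simp
    show "jet_param k s ` supp_in (jet_idx m n k s) \<subseteq> aff m n k"
      using assms(2,3) jet_idx_subset by (rule jet_param_image_aff)
  qed (use * in auto)
  then show ?thesis using c0 by simp
qed

section \<open>The locus as a finite union of irreducible closed sets\<close>

lemma Vloc_subset_Yloc:
  assumes "2 * s \<le> k" "0 < m" "0 < n"
  shows "Vloc m n k s \<subseteq> Yloc m n k s"
  unfolding Vloc_def
  by (rule zclosure_minimal[OF zclosed_Yloc]) (use rk1_imp_Yloc[OF jet_param_rk1] assms in blast)

text \<open>Points of order exactly \<open>s\<close> factor and so lie in \<open>Vloc\<close>.
  Conversely, the parameter at \<open>(0, 0, s)\<close> is itself a coefficient of the jet, so
  varying it makes every parametrized jet a limit of jets of order exactly \<open>s\<close>.\<close>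

lemma zclosure_order_s_eq_Vloc:
  assumes "2 * s < k" "0 < m" "0 < n"
  shows "zclosure m n k {p \<in> Yloc m n k s. \<exists>i<m. \<exists>j<n. p i j s \<noteq> 0} =
    (Vloc m n k s :: 'a::alg_closed_field pt set)" (is "zclosure m n k ?T = _")
proof (rule antisym)
  have "zclosed m n k (Vloc m n k s)"
    unfolding Vloc_def using jet_param_image_aff[OF assms(2,3) jet_idx_subset] by (rule zclosed_zclosure)
  moreover have "?T \<subseteq> Vloc m n k s"
  proof
    fix p assume "p \<in> ?T"
    then obtain u v where "rk1 m n k s u v p"
      using Yloc_imp_rk1[of p m n k s] assms(1) by fastforce
    then show "p \<in> Vloc m n k s" using assms(2,3) by (rule rk1_in_Vloc)
  qed
  ultimately show "zclosure m n k ?T \<subseteq> Vloc m n k s" by (rule zclosure_minimal)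
  have T: "?T \<subseteq> aff m n k" using Yloc_subset_aff by blast
  have "jet_param k s q \<in> zclosure m n k ?T" if q: "q \<in> supp_in (jet_idx m n k s)" for q
  proof -
    define c where "c t = (\<lambda>i j l. q i j l + t * (if (i, j, l) = (0, 0, s) then 1 else 0))" for t
    have c: "c t \<in> supp_in (jet_idx m n k s)" for t
      using q assms unfolding c_def supp_in_def jet_idx_def by auto
    have c0: "c 0 = q" unfolding c_def by simp
    have T_c: "jet_param k s (c t) \<in> ?T" if "t \<notin> {- q 0 0 s}" for t
    proof -
      have "jet_param k s (c t) \<in> Yloc m n k s"
        using rk1_imp_Yloc[OF jet_param_rk1[OF c]] assms by auto
      moreover have "jet_param k s (c t) 0 0 s \<noteq> 0"
        using that unfolding jet_param_def c_def by (auto simp: eq_neg_iff_add_eq_0 add.commute)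
      ultimately show ?thesis using assms(2,3) by blast
    qed
    have "is_poly (\<lambda>t. c t i j l)" for i j l
      unfolding c_def by (intro is_poly_add is_poly_mult is_poly_const is_poly_id)
    then have ip: "is_poly (\<lambda>t. jet_param k s (c t) i j l)" for i j l
      using is_poly_polyfun[where c = c, OF pf_jet_param[of k s i j l]] by blast
    have fin: "finite {- q 0 0 s}" by simp
    have a: "jet_param k s (c 0) \<in> aff m n k"
      using jet_param_image_aff[OF assms(2,3) jet_idx_subset] c by blast
    show ?thesis
      using zclosure_curve[where c = "\<lambda>t. jet_param k s (c t)", OF T ip fin T_c a] c0 by simp
  qed
  then show "Vloc m n k s \<subseteq> zclosure m n k ?T"
    unfolding Vloc_def by (intro zclosure_minimal[OF zclosed_zclosure[OF T]]) blast
qed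

lemma Yloc_half_eq_Vloc:
  assumes "0 < m" "0 < n"
  shows "Yloc m n k (k div 2) = (Vloc m n k (k div 2) :: 'a::alg_closed_field pt set)"
proof (rule antisym)
  show "Vloc m n k (k div 2) \<subseteq> (Yloc m n k (k div 2) :: 'a pt set)"
    using assms by (intro Vloc_subset_Yloc) auto
  show "Yloc m n k (k div 2) \<subseteq> (Vloc m n k (k div 2) :: 'a pt set)"
  proof
    fix p :: "'a pt" assume p: "p \<in> Yloc m n k (k div 2)"
    have "\<exists>u v. rk1 m n k (k div 2) u v p"
    proof (cases "\<exists>i<m. \<exists>j<n. p i j (k div 2) \<noteq> 0")
      case True
      then show ?thesis using Yloc_imp_rk1[OF p] by auto
    next
      case False
      have "l = k div 2" if "k div 2 \<le> l" "l < k - k div 2" for l using that by linarith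
      then have "rk1 m n k (k div 2) (\<lambda>_. 0) (\<lambda>_. 0) p"
          using p False Yloc_subset_aff[of m n k "k div 2"] unfolding rk1_def Yloc_def by fastforce
      then show ?thesis by blast
    qed
    then show "p \<in> Vloc m n k (k div 2)" using rk1_in_Vloc assms by blast
  qed
qed

lemma Zlocus_eq_UN_Vloc:
  assumes "0 < m" "0 < n"
  shows "Zlocus m n 2 k = (\<Union>s\<le>k div 2. Vloc m n k s :: 'a::alg_closed_field pt set)"
proof (rule antisym)
  have "Vloc m n k s \<subseteq> (Zlocus m n 2 k :: 'a pt set)" if "s \<le> k div 2" for s
  proof -
    have "2 * s \<le> k" using that by linarith
    from Vloc_subset_Yloc[OF this assms] show ?thesis unfolding Yloc_def by blast
  qed
  then show "(\<Union>s\<le>k div 2. Vloc m n k s) \<subseteq> (Zlocus m n 2 k :: 'a pt set)" by blast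
  show "Zlocus m n 2 k \<subseteq> (\<Union>s\<le>k div 2. Vloc m n k s :: 'a pt set)"
  proof
    fix p :: "'a pt" assume p: "p \<in> Zlocus m n 2 k"
    show "p \<in> (\<Union>s\<le>k div 2. Vloc m n k s)"
    proof (cases "p \<in> Yloc m n k (k div 2)")
      case True
      then show ?thesis using Yloc_half_eq_Vloc[OF assms] by auto
    next
      case False
      define P where "P l \<longleftrightarrow> (\<exists>i<m. \<exists>j<n. p i j l \<noteq> 0)" for l
      have "\<exists>l<k div 2. P l" using False p unfolding Yloc_def P_def by auto
      then obtain l where l: "l < k div 2" "P l" by blast
      define s where "s = (LEAST l. P l)"
      have s: "P s" "s \<le> l" unfolding s_def using l(2) by (rule LeastI, rule Least_le)
      have "\<not> P l'" if "l' < s" for l' using that unfolding s_def by (rule not_less_Least)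
      then have "p \<in> {p \<in> Yloc m n k s. \<exists>i<m. \<exists>j<n. p i j s \<noteq> 0}"
        using p s(1) unfolding Yloc_def P_def by blast
      then have "p \<in> zclosure m n k {p \<in> Yloc m n k s. \<exists>i<m. \<exists>j<n. p i j s \<noteq> 0}"
        by (rule subsetD[OF subset_zclosure])
      moreover have "2 * s < k" using s(2) l(1) by linarith
      ultimately have "p \<in> Vloc m n k s"
        using zclosure_order_s_eq_Vloc[of s k m n, OF _ assms] by blast
      then show ?thesis using s(2) l(1) by auto
    qed
  qed
qed

section \<open>Codimensions\<close>

lemma card_jet_idx_compl:
  assumes "2 * s \<le> k"
  shows "card (idx m n k - jet_idx m n k s) = (m - 1) * (n - 1) * (k - 2 * s) + m * n * s"
proof -
  have "idx m n k - jet_idx m n k s =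
    {1..<m} \<times> {1..<n} \<times> {s..<k - s} \<union> {..<m} \<times> {..<n} \<times> {..<s}"
    using assms unfolding jet_idx_def idx_def by auto
  also have "card \<dots> = (m - 1) * ((n - 1) * (k - s - s)) + m * (n * s)"
    by (subst card_Un_disjoint) (auto simp: card_cartesian_product)
  finally show ?thesis by (simp add: mult.assoc mult_2)
qed

text \<open>The order in which the parameters are switched on in the flag through \<open>Vloc m n k s\<close>,
  and a function detecting each of them. A parameter $q_{i,j}^{(l)}$ with $i, j \ge 1$ and
  $s \le l < k - s$ is detected by the $2 \times 2$ minor
  $v_0 (u_i v_j + e_{i,j}) - (u_i v_0) v_j = v_0 e_{i,j}$, provided that the coefficients of
  $e_{i,j}$ below $t^{l - s}$ are still zero.\<close>
definition jet_rank :: "nat \<Rightarrow> nat \<Rightarrow> nat \<times> nat \<times> nat \<Rightarrow> nat" where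
  "jet_rank k s = (\<lambda>(i, j, l). if l < s then k + 4
     else if k - s \<le> l \<or> i = 0 then if (i, j, l) = (0, 0, s) then 0 else 2
     else if j = 0 then 1 else 3 + (k - l))"

definition jet_test :: "nat \<Rightarrow> nat \<Rightarrow> nat \<times> nat \<times> nat \<Rightarrow> 'a::comm_ring_1 pt \<Rightarrow> 'a" where
  "jet_test k s = (\<lambda>(i, j, l) p. if l < s \<or> k - s \<le> l \<or> i = 0 \<or> j = 0 then p i j l
     else \<Sum>b\<le>l - s. p 0 0 (s + b) * p i j (l - b) - p i 0 (s + b) * p 0 j (l - b))"

lemma pf_jet_test: "jet_test k s x \<in> polyfun"
proof -
  obtain i j l where x: "x = (i, j, l)" by (cases x) auto
  have "(\<lambda>p :: 'a pt. \<Sum>b\<le>l - s. p 0 0 (s + b) * p i j (l - b) - p i 0 (s + b) * p 0 j (l - b)) \<in> polyfun"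
    by (rule pf_sum) (rule pf_diff[OF pf_mult[OF pf_var pf_var] pf_mult[OF pf_var pf_var]])
  then show ?thesis
    unfolding jet_test_def x by (cases "l < s \<or> k - s \<le> l \<or> i = 0 \<or> j = 0") (auto intro: pf_var)
qed

text \<open>Where \<open>jet_param\<close> copies a parameter, the coordinate itself is the test. A
  parameter of \<open>u\<close> has rank 1, so \<open>v_0\<close> is then only its leading
  coefficient (rank 0; the rest of row 0 has rank 2) and the coefficient of \<open>u_i v_0\<close>
  contains no other parameter of \<open>u\<close>. The \<open>e_(i,j)\<close> are ordered by
  decreasing \<open>l\<close>, so the terms \<open>q i j (l - b)\<close> with \<open>b > 0\<close>
  are still off and the minor reduces to \<open>W * (U * V) - (U * W) * V\<close>. The rank
  \<open>k + 4\<close> puts the coefficients below \<open>t^s\<close> last.\<close>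

lemma jet_test_vanishes:
  assumes "x \<in> idx m n k"
    and q: "q \<in> supp_in {y \<in> idx m n k. jet_rank k s y \<le> jet_rank k s x \<and> y \<noteq> x}"
  shows "jet_test k s x (jet_param k s q) = 0"
proof -
  obtain i j l where x: "x = (i, j, l)" by (cases x) auto
  have l: "l < k" using assms(1) x by simp
  have qx: "q i j l = 0" using q unfolding supp_in_def x by auto
  have qr: "q i' j' l' = 0" if "jet_rank k s (i', j', l') > jet_rank k s (i, j, l)" for i' j' l'
    using q that unfolding supp_in_def x by auto
  have "{y \<in> idx m n k. jet_rank k s y \<le> jet_rank k s x \<and> y \<noteq> x} \<subseteq> idx m n k" by blast
  from supp_in_mono[OF this] have qa: "q \<in> aff m n k"
    using q unfolding aff_eq_supp_in by (rule subsetD)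
  consider "l < s \<or> k - s \<le> l \<or> i = 0" | "s \<le> l" "l < k - s" "i \<noteq> 0" "j = 0"
    | "s \<le> l" "l < k - s" "i \<noteq> 0" "j \<noteq> 0" by linarith
  then show ?thesis
  proof cases
    case 1
    then show ?thesis using qx by (auto simp: jet_test_def jet_param_def x)
  next
    case 2
    have "q i 0 (s + a) * q 0 0 (l - a) = 0" if "a \<le> l - s" for a
    proof (cases "a = l - s")
      case True
      then show ?thesis using 2 qx by simp
    next
      case False
      then have "q 0 0 (l - a) = 0"
        using 2 that by (intro qr) (auto simp: jet_rank_def)
      then show ?thesis by simp
    qed
    then show ?thesis using 2 by (simp add: jet_test_def jet_param_def x)
  next
    case 3
    define U V W where "U = ser k s q i 0" "V = ser k s q 0 j" "W = ser k s q 0 0"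
    have j0: "jet_param k s q 0 j' l' = q 0 j' l'" for j' l' by (simp add: jet_param_def)
    have 1: "jet_param k s q 0 0 (s + b) * jet_param k s q i j (l - b) = coeff W b * coeff (U * V) (l - s - b)"
      if "b \<le> l - s" for b
    proof -
      have "q i j (l - b) = 0"
      proof (cases "b = 0")
        case False
        then show ?thesis using 3 l that by (intro qr) (auto simp: jet_rank_def)
      qed (use qx in simp)
      moreover have "l - b - s = l - s - b" by simp
      ultimately have "jet_param k s q i j (l - b) = coeff (U * V) (l - s - b)"
        using 3 that by (subst jet_param_coeff[OF qa]) (auto simp: U_V_W_def)
      then show ?thesis by (simp add: j0 U_V_W_def coeff_ser[OF qa])
    qed
    have 2: "jet_param k s q i 0 (s + b) * jet_param k s q 0 j (l - b) = coeff (U * W) b * coeff V (l - s - b)"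
      if "b \<le> l - s" for b
    proof -
      have "s + (l - s - b) = l - b" using that 3(1) by linarith
      moreover have "jet_param k s q i 0 (s + b) = coeff (U * W) b"
        using 3 that by (subst jet_param_coeff[OF qa]) (auto simp: U_V_W_def)
      ultimately show ?thesis by (simp add: j0 U_V_W_def coeff_ser[OF qa])
    qed
    have "jet_test k s x (jet_param k s q) =
      (\<Sum>b\<le>l - s. coeff W b * coeff (U * V) (l - s - b) - coeff (U * W) b * coeff V (l - s - b))"
      using 3 unfolding jet_test_def x by (auto intro!: sum.cong simp: 1 2)
    also have "\<dots> = coeff (W * (U * V)) (l - s) - coeff (U * W * V) (l - s)"
      unfolding sum_subtractf coeff_mult[of W] coeff_mult[of "U * W"] by (rule refl)
    also have "\<dots> = 0" by (simp add: mult_ac)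
    finally show ?thesis .
  qed
qed

text \<open>In the cases where a product is involved, \<open>v_0 = 1\<close> at this point, so the
  test reads the parameter \<open>x\<close> undistorted; its value is 1 throughout.\<close>

lemma jet_test_nonzero: "jet_test k s x (jet_param k s (ind_pt {(0, 0, s), x})) \<noteq> (0 :: 'a::comm_ring_1)"
proof -
  obtain i j l where x: "x = (i, j, l)" by (cases x) auto
  define q where "q = (ind_pt {(0, 0, s), (i, j, l)} :: 'a pt)"
  have q: "q i' j' l' = (if (i', j', l') = (0, 0, s) \<or> (i', j', l') = (i, j, l) then 1 else 0)" for i' j' l'
    unfolding q_def ind_pt_def by auto
  have j0: "jet_param k s q 0 j' l' = q 0 j' l'" for j' l' by (simp add: jet_param_def)
  consider "l < s \<or> k - s \<le> l \<or> i = 0" | "s \<le> l" "l < k - s" "i \<noteq> 0" "j = 0"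
    | "s \<le> l" "l < k - s" "i \<noteq> 0" "j \<noteq> 0" by linarith
  then have "jet_test k s x (jet_param k s q) = 1"
  proof cases
    case 1
    then show ?thesis by (auto simp: jet_test_def jet_param_def x q)
  next
    case 2
    have "(\<Sum>a\<le>l - s. q i 0 (s + a) * q 0 0 (l - a)) = (\<Sum>a\<le>l - s. if a = l - s then 1 else 0)"
      using 2 by (intro sum.cong) (auto simp: q)
    then show ?thesis using 2 by (simp add: jet_test_def jet_param_def x)
  next
    case 3
    have "q i 0 l' = 0" for l' using 3 by (simp add: q)
    then have jp: "jet_param k s q i j' l' = (if j' = 0 then 0 else q i j' l')"
      if "s \<le> l'" "l' < k - s" for j' l'
      using that 3 by (simp add: jet_param_def)
    have "jet_test k s x (jet_param k s q) = (\<Sum>b\<le>l - s. jet_param k s q 0 0 (s + b) *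
        jet_param k s q i j (l - b) - jet_param k s q i 0 (s + b) * jet_param k s q 0 j (l - b))"
      using 3 by (simp add: jet_test_def x)
    also have "\<dots> = (\<Sum>b\<le>l - s. if b = 0 then 1 else 0)"
    proof (rule sum.cong[OF refl])
      fix b assume "b \<in> {..l - s}"
      then have "s \<le> l - b" "l - b < k - s" "s + b < k - s" using 3 by auto
      then show "jet_param k s q 0 0 (s + b) * jet_param k s q i j (l - b) -
          jet_param k s q i 0 (s + b) * jet_param k s q 0 j (l - b) = (if b = 0 then 1 else 0)"
        using 3 by (simp add: jp j0 q)
    qed
    finally show ?thesis by simp
  qed
  then show ?thesis by (simp add: q_def x)
qed

lemma zchain_Vloc:
  fixes m n k s :: nat
  assumes "2 * s \<le> k" "0 < k" "0 < m" "0 < n" "S \<subseteq> T" "T \<subseteq> idx m n k"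
    "\<And>x y. x \<in> T - S \<Longrightarrow> y \<in> S \<Longrightarrow> jet_rank k s y \<le> jet_rank k s x" "(0, 0, s) \<in> T"
  shows "zchain m n k (card (T - S)) (zclosure m n k (jet_param k s ` supp_in S))
    (zclosure m n k (jet_param k s ` supp_in T) :: 'a::alg_closed_field pt set)"
proof (rule zchain_flag[where I = "idx m n k" and b = "(0, 0, s)" and rk = "jet_rank k s" and g = "jet_test k s"])
  show "jet_param k s ` supp_in (idx m n k) \<subseteq> aff m n k"
    using assms(3,4) by (intro jet_param_image_aff) auto
  show "jet_rank k s (0, 0, s) < jet_rank k s x" if "x \<in> idx m n k" "x \<noteq> (0, 0, s)" for x
    using that by (cases x) (auto simp: jet_rank_def)
  show "jet_test k s x (jet_param k s q) = 0"
    if "x \<in> idx m n k" "q \<in> supp_in {y \<in> idx m n k. jet_rank k s y \<le> jet_rank k s x \<and> y \<noteq> x}"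
    for x and q :: "'a pt"
    using that by (rule jet_test_vanishes)
qed (use assms in \<open>simp_all add: pf_jet_param pf_jet_test jet_test_nonzero\<close>)

text \<open>Parameters in \<open>jet_idx\<close> have rank at most 2 and all others at least 3, so
  \<open>Vloc\<close> is a member of the flag. Its codimension is the number of parameters still off
  there.\<close>

lemma zcodim_Vloc:
  assumes "2 * s \<le> k" "0 < k" "0 < m" "0 < n"
  shows "zcodim m n k (Vloc m n k s :: 'a::alg_closed_field pt set) =
    (m - 1) * (n - 1) * (k - 2 * s) + m * n * s"
proof -
  let ?J = "jet_idx m n k s" and ?I = "idx m n k"
  let ?D = "\<lambda>A. zclosure m n k (jet_param k s ` supp_in A) :: 'a pt set"
  have b: "(0, 0, s) \<in> ?J" using assms unfolding jet_idx_def by auto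
  have "zchain m n k (card (?J - {})) (?D {}) (?D ?J)"
    using b by (intro zchain_Vloc assms jet_idx_subset) auto
  moreover have "zchain m n k (card (?I - ?J)) (?D ?J) (?D ?I)"
  proof (intro zchain_Vloc assms jet_idx_subset subset_refl)
    show "jet_rank k s y \<le> jet_rank k s x" if "x \<in> ?I - ?J" "y \<in> ?J" for x y
      using that by (cases x; cases y) (auto simp: jet_idx_def jet_rank_def)
  qed (use b jet_idx_subset in blast)
  moreover have "card (?J - {}) + card (?I - ?J) = m * n * k"
    using card_Diff_subset[OF finite_subset[OF jet_idx_subset[of m n k s]] jet_idx_subset[of m n k s]]
      card_mono[OF _ jet_idx_subset[of m n k s]] by simp
  ultimately have "zcodim m n k (?D ?J) = card (?I - ?J)" by (rule zcodim_eqI)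
  then show ?thesis unfolding Vloc_def card_jet_idx_compl[OF assms(1)] .
qed

section \<open>The closed sets do not contain one another\<close>

definition det3 :: "nat \<Rightarrow> 'a::comm_ring_1 pt \<Rightarrow> 'a poly" where
  "det3 k p = xpoly k p 0 0 * (xpoly k p 1 1 * xpoly k p 2 2 - xpoly k p 1 2 * xpoly k p 2 1)
    - xpoly k p 0 1 * (xpoly k p 1 0 * xpoly k p 2 2 - xpoly k p 1 2 * xpoly k p 2 0)
    + xpoly k p 0 2 * (xpoly k p 1 0 * xpoly k p 2 1 - xpoly k p 1 1 * xpoly k p 2 0)"

lemma pf_coeff_det3: "(\<lambda>p. coeff (det3 k p) l) \<in> polyfun"
proof -
  have "(\<lambda>p. coeff (xpoly k p a b * (xpoly k p c d * xpoly k p e f - xpoly k p c' d' * xpoly k p e' f')) l) \<in> polyfun"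
    for a b c d e f c' d' e' f' l
  proof (rule pf_coeff_mult[OF pf_coeff_xpoly])
    show "(\<lambda>p. coeff (xpoly k p c d * xpoly k p e f - xpoly k p c' d' * xpoly k p e' f') l) \<in> polyfun" for l
      unfolding coeff_diff
      by (rule pf_diff[OF pf_coeff_mult[OF pf_coeff_xpoly pf_coeff_xpoly]
            pf_coeff_mult[OF pf_coeff_xpoly pf_coeff_xpoly]])
  qed
  note * = this
  show ?thesis unfolding det3_def coeff_add coeff_diff[of "_ * (_ - _)"]
    by (rule pf_add[OF pf_diff[OF * *] *])
qed

text \<open>The determinant of $u v^T + E R$ has no terms of order less than two in $E$.\<close>
lemma rk1_det3:
  assumes "rk1 m n k s u v p" "2 * s \<le> k" "3 \<le> m" "3 \<le> n"
  shows "monom 1 (2 * k - s) dvd det3 k p"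
proof -
  define T E where "T = monom (1::'a) s" "E = monom (1::'a) (k - 2 * s)"
  obtain R where R: "\<And>i j. i < m \<Longrightarrow> j < n \<Longrightarrow> xpoly k p i j = T * (u i * v j + E * R i j)"
    using rk1_xpoly[OF assms(1,2)] unfolding T_E_def by blast
  have "2 * k - s = s + s + s + (k - 2 * s) + (k - 2 * s)" using assms(2) by simp
  then have k: "monom 1 (2 * k - s) = T * T * T * E * E" by (simp add: T_E_def mult_monom)
  have x: "xpoly k p i j = T * (u i * v j + E * R i j)" if "i \<in> {0, 1, 2}" "j \<in> {0, 1, 2}" for i j
    using R that assms(3,4) by auto
  show ?thesis
  proof (rule dvdI)
    show "det3 k p = monom 1 (2 * k - s) *
      (u 0 * (v 0 * (R 1 1 * R 2 2 - R 1 2 * R 2 1) - v 1 * (R 1 0 * R 2 2 - R 1 2 * R 2 0)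
          + v 2 * (R 1 0 * R 2 1 - R 1 1 * R 2 0))
       - u 1 * (v 0 * (R 0 1 * R 2 2 - R 0 2 * R 2 1) - v 1 * (R 0 0 * R 2 2 - R 0 2 * R 2 0)
          + v 2 * (R 0 0 * R 2 1 - R 0 1 * R 2 0))
       + u 2 * (v 0 * (R 0 1 * R 1 2 - R 0 2 * R 1 1) - v 1 * (R 0 0 * R 1 2 - R 0 2 * R 1 0)
          + v 2 * (R 0 0 * R 1 1 - R 0 1 * R 1 0))
       + E * (R 0 0 * (R 1 1 * R 2 2 - R 1 2 * R 2 1) - R 0 1 * (R 1 0 * R 2 2 - R 1 2 * R 2 0)
          + R 0 2 * (R 1 0 * R 2 1 - R 1 1 * R 2 0)))"
      unfolding det3_def k by (simp add: x algebra_simps)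
  qed
qed

text \<open>The separating point is the diagonal matrix with entries $t^{s'}, t^{k-s'}, t^{k-s'}$, whose
  determinant has order $2k - s' < 2k - s$.\<close>
lemma Vloc_not_subset_of_less:
  assumes "s < s'" "2 * s' \<le> k" "3 \<le> m" "3 \<le> n"
  shows "\<not> Vloc m n k s' \<subseteq> (Vloc m n k s :: 'a::alg_closed_field pt set)"
proof
  assume sub: "Vloc m n k s' \<subseteq> (Vloc m n k s :: 'a pt set)"
  have pos: "0 < m" "0 < n" using assms by auto
  \<comment> \<open>Level \<open>k - s'\<close> is the first one left free at order
    \<open>s'\<close>, so two further diagonal entries can be placed there without leaving
    \<open>Vloc m n k s'\<close>.\<close>
  define w :: "'a pt" where "w = ind_pt {(0, 0, s'), (1, 1, k - s'), (2, 2, k - s')}"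
  have "rk1 m n k s' (\<lambda>i. if i = 0 then 1 else 0) (\<lambda>j. if j = 0 then 1 else 0) w"
    unfolding rk1_def w_def ind_pt_def aff_def using assms by (auto simp: coeff_eq_0 coeff_1)
  then have "w \<in> Vloc m n k s" using rk1_in_Vloc[OF _ pos] sub by blast
  then have "coeff (det3 k w) (2 * k - s') = 0"
    unfolding Vloc_def
  proof (rule polyfun_zero_zclosure[OF jet_param_image_aff[OF pos jet_idx_subset] pf_coeff_det3, rotated])
    fix p :: "'a pt" assume "p \<in> jet_param k s ` supp_in (jet_idx m n k s)"
    then obtain u v where "rk1 m n k s u v p" using jet_param_rk1 pos by blast
    then have "monom 1 (2 * k - s) dvd det3 k p"
      using rk1_det3[of m n k s u v p] assms by simp
    then show "coeff (det3 k p) (2 * k - s') = 0"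
      using assms unfolding monom_1_dvd_iff' by simp
  qed
  moreover have "xpoly k w i j = (if i = j \<and> i = 0 then monom 1 s'
      else if i = j \<and> i \<le> 2 then monom 1 (k - s') else 0)" for i j
    using assms by (intro poly_eqI) (auto simp: coeff_xpoly w_def ind_pt_def)
  then have "det3 k w = monom 1 s' * (monom 1 (k - s') * monom 1 (k - s'))"
    unfolding det3_def by simp
  then have "det3 k w = monom 1 (2 * k - s')"
    using assms by (simp add: mult_monom mult_2)
  ultimately show False by simp
qed

text \<open>The jet with single entry \<open>t^s\<close> at \<open>(0, 0)\<close> lies in the
  \<open>s\<close>-th closure, while coefficients at level \<open>s < s'\<close> vanish on all of
  \<open>Yloc m n k s'\<close>.\<close>

lemma Vloc_not_subset_of_greater:
  assumes "s < s'" "2 * s' \<le> k" "0 < k" "0 < m" "0 < n"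
  shows "\<not> Vloc m n k s \<subseteq> (Vloc m n k s' :: 'a::alg_closed_field pt set)"
proof
  assume sub: "Vloc m n k s \<subseteq> (Vloc m n k s' :: 'a pt set)"
  define q :: "'a pt" where "q = ind_pt {(0, 0, s)}"
  have "q \<in> supp_in (jet_idx m n k s)"
    using assms unfolding q_def ind_pt_def supp_in_def jet_idx_def by auto
  then have "jet_param k s q \<in> Vloc m n k s"
    unfolding Vloc_def using subset_zclosure by blast
  then have "jet_param k s q \<in> Yloc m n k s'" using sub Vloc_subset_Yloc assms by blast
  then have "jet_param k s q 0 0 s = 0" using assms unfolding Yloc_def by blast
  then show False by (simp add: jet_param_def q_def ind_pt_def)
qed

lemma Vloc_subset_imp_eq:
  assumes "s \<le> k div 2" "s' \<le> k div 2" "0 < k" "3 \<le> m" "3 \<le> n"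
    "Vloc m n k s \<subseteq> (Vloc m n k s' :: 'a::alg_closed_field pt set)"
  shows "s = s'"
proof -
  have "2 * s \<le> k" "2 * s' \<le> k" "0 < m" "0 < n" using assms by linarith+
  then show ?thesis
    using Vloc_not_subset_of_less[of s' s k m n] Vloc_not_subset_of_greater[of s s' k m n] assms
    by (metis nat_neq_iff)
qed

theorem theorem5p1:
  fixes m n k L :: nat
    and Z :: "'a::alg_closed_field pt set"
    and Y X :: "nat \<Rightarrow> 'a pt set"
  assumes "3 \<le> m" and "m \<le> n" and "2 \<le> k"
  defines "L \<equiv> k div 2"
    and "Z \<equiv> Zlocus m n 2 k"
    and "Y \<equiv> (\<lambda>s. {p \<in> Z. \<forall>i<m. \<forall>j<n. \<forall>l<s. p i j l = 0})"
    and "X \<equiv> (\<lambda>s. zclosure m n k {p \<in> Y s. \<exists>i<m. \<exists>j<n. p i j s \<noteq> 0})"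
  shows "\<not> zirreducible m n k Z
     \<and> {C. zcomponent m n k Z C} = X ` {..<L} \<union> {Y L}
     \<and> inj_on (\<lambda>s. if s < L then X s else Y L) {..L}
     \<and> (\<forall>s<L. zcodim m n k (X s) = (m - 1) * (n - 1) * (k - 2 * s) + m * n * s)
     \<and> zcodim m n k (Y L) = (if k = 2 * L then m * n * L else (m - 1) * (n - 1) + m * n * L)"
proof -
  have pos: "0 < m" "0 < n" "0 < k" "3 \<le> n" using assms(1-3) by auto
  let ?V = "\<lambda>s. Vloc m n k s :: 'a pt set"
  have Y: "Y s = Yloc m n k s" for s unfolding Y_def Z_def Yloc_def by (rule refl)
  have X: "X s = ?V s" if "s < L" for s
  proof -
    have "2 * s < k" using that unfolding L_def by linarith
    then show ?thesis unfolding X_def Y using pos(1,2) by (rule zclosure_order_s_eq_Vloc)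
  qed
  have YL: "Y L = ?V L" unfolding Y L_def using pos(1,2) by (rule Yloc_half_eq_Vloc)
  have V: "(if s < L then X s else Y L) = ?V s" if "s \<le> L" for s using that X YL by auto
  have irr: "zirreducible m n k (?V s)" for s using pos by (intro zirreducible_Vloc)
  have Z: "Z = (\<Union>s\<in>{..L}. ?V s)" unfolding Z_def L_def using pos(1,2) by (rule Zlocus_eq_UN_Vloc)
  have V_sub: "s = s'" if "s \<in> {..L}" "s' \<in> {..L}" "?V s \<subseteq> ?V s'" for s s'
    using Vloc_subset_imp_eq[of s k s' m n] that pos assms(1) unfolding L_def by simp
  have comps: "{C. zcomponent m n k Z C} = ?V ` {..L}"
    by (rule zcomponents_irredundant_cover[OF _ irr Z V_sub]) simp_all
  have "?V ` {..L} = X ` {..<L} \<union> {Y L}"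
  proof -
    have "{..L} = insert L {..<L}" by auto
    then show ?thesis using X YL by auto
  qed
  moreover have "\<not> zirreducible m n k Z"
  proof
    assume "zirreducible m n k Z"
    \<comment> \<open>By maximality of components, an irreducible \<open>Z\<close> would equal each
      \<open>?V s\<close>; taking \<open>s = 0\<close> and \<open>s = L\<close> is contradictory
      since \<open>k \<ge> 2\<close> makes \<open>L\<close> positive.\<close>
    have "Z = ?V s" if "s \<le> L" for s
    proof -
      have "?V s \<subseteq> Z" using Z that by blast
      moreover have "zcomponent m n k Z (?V s)" using comps that by blast
      ultimately show ?thesis using \<open>zirreducible m n k Z\<close> unfolding zcomponent_def by blast
    qed
    from this[of 0] this[of L] have "?V 0 = ?V L" by simp
    then have "0 = L" using V_sub[of 0 L] by simp
    then show False using assms(3) unfolding L_def by simp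
  qed
  moreover have "inj_on (\<lambda>s. if s < L then X s else Y L) {..L}"
  proof (rule inj_onI)
    fix s s' assume s: "s \<in> {..L}" "s' \<in> {..L}"
      "(if s < L then X s else Y L) = (if s' < L then X s' else Y L)"
    then have "?V s = ?V s'" using V by simp
    then show "s = s'" using V_sub s(1,2) by blast
  qed
  moreover have cod: "zcodim m n k (?V s) = (m - 1) * (n - 1) * (k - 2 * s) + m * n * s" if "s \<le> L" for s
  proof -
    have "2 * s \<le> k" using that unfolding L_def by linarith
    then show ?thesis using pos by (intro zcodim_Vloc)
  qed
  moreover have "\<forall>s<L. zcodim m n k (X s) = (m - 1) * (n - 1) * (k - 2 * s) + m * n * s"
    using cod X by simp
  \<comment> \<open>The two parities make the factor \<open>k - 2 * L\<close> of the general formula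
    0 or 1.\<close>
  moreover have "k = 2 * L \<or> k = 2 * L + 1" unfolding L_def by linarith
  then have "zcodim m n k (Y L) = (if k = 2 * L then m * n * L else (m - 1) * (n - 1) + m * n * L)"
    using cod[of L] YL by auto
  ultimately show ?thesis using comps by simp
qed

end
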